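(* Let $(\tau,s)\in\mathcal{D}$ and assume that all subdifferentials $\partial f_i$ ($i=1,\dots,p$) and $\partial g_j$ ($j=1,\dots,q$) are piecewise linear multifunctions. Let the sequence $\{\mathbf{w}^k\}$ be generated by GS-ADMM, and let $\epsilon>0$ be the constant defined in the context. Then there exists a point $\mathbf{w}^\infty\in\mathcal{M}^*$ such that $$\left\|\mathbf{w}^k-\mathbf{w}^\infty\right\|_{H}\leq C r^k\quad\text{for all } k\ge 0,$$ where $$C=\frac{2\,\mathrm{dist}_{H}(\mathbf{w}^0,\mathcal{M}^* )}{1-r}>0\qquad\text{and}\qquad r=\frac{1}{\sqrt{1+\epsilon}}\in(0,1).$$
   Context: Problem. Let $p,q\ge 1$ be integers. Consider $$\min \sum_{i=1}^{p}f_i(x_i)+ \sum_{j=1}^{q}g_j(y_j)\quad \text{s.t. } \sum_{i=1}^{p}A_i x_i+\sum_{j=1}^{q}B_jy_j=c,\ x_i\in \mathcal{X}_i\ (i=1,\dots,p),\ y_j\in \mathcal{Y}_j\ (j=1,\dots,q),$$ where $f_i:\mathbb{R}^{m_i}\to\mathbb{R}$, $g_j:\mathbb{R}^{d_j}\to\mathbb{R}$ are closed proper convex functions (possibly nonsmooth), $A_i\in\mathbb{R}^{n\times m_i}$, $B_j\in\mathbb{R}^{n\times d_j}$, $c\in\mathbb{R}^n$, and $\mathcal{X}_i\subset\mathbb{R}^{m_i}$, $\mathcal{Y}_j\subset\mathbb{R}^{d_j}$ are polyhedra. Standing assumptions: the solution set of this problem is nonempty and all $A_i$, $B_j$ have full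 column rank. A multifunction $\phi$ is piecewise linear if its graph $\{(x,y)\mid y\in\phi(x)\}$ is a union of finitely many polyhedra. Notation. $\mathcal{A}=[A_1,\dots,A_p]$, $\mathcal{B}=[B_1,\dots,B_q]$, $\mathbf{x}=(x_1,\dots,x_p)$, $\mathbf{y}=(y_1,\dots,y_q)$, $\mathbf{u}=(\mathbf{x},\mathbf{y})$, $\mathbf{w}=(\mathbf{x},\mathbf{y},\lambda)$ with $\lambda\in\mathbb{R}^n$. $\mathcal{X}=\mathcal{X}_1\times\cdots\times\mathcal{X}_p$, $\mathcal{Y}=\mathcal{Y}_1\times\cdots\times\mathcal{Y}_q$, $\mathcal{M}=\mathcal{X}\times\mathcal{Y}\times\mathbb{R}^n$. $\|\cdot\|$ is the Euclidean norm; $\|x\|_G^2=x^{\sf T}Gx$ for symmetric $G$; $\lambda_{\max},\lambda_{\min}$ are the largest and smallest eigenvalues; $\partial f$ is the convex subdifferential. For $\beta>0$, $$\mathcal{L}_\beta(\mathbf{x},\mathbf{y},\lambda)=\sum_{i=1}^p f_i(x_i)+\sum_{j=1}^q g_j(y_j)-\langle\lambda,\mathcal{A}\mathbf{x}+\mathcal{B}\mathbf{y}-c\rangle+\frac{\beta}{2}\|\mathcal{A}\mathbf{x}+\mathcal{B}\mathbf{y}-c\|^2 .$$ GS-ADMM. Parameters: $\beta>0$, $\sigma_1\in(p-1,+\infty)$, $\sigma_2\in(q-1,+\infty)$, and stepsizes $(\tau,s)\in\mathcal{D}:=\{(\tau,s)\mid \tau<1,\ s<1,\ \tau+s>0\}$.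 From an initial point $\mathbf{w}^0=(\mathbf{x}^0,\mathbf{y}^0,\lambda^0)$, for $k=0,1,2,\dots$: - $x_i^{k+1}=\arg\min_{x_i\in\mathcal{X}_i}\mathcal{L}_\beta(x_1^k,\dots,x_i,\dots,x_p^k,\mathbf{y}^k,\lambda^k)+\frac{\sigma_1\beta}{2}\|A_i(x_i-x_i^k)\|^2$, for $i=1,\dots,p$; - $\lambda^{k+\frac12}=\lambda^k-\tau\beta(\mathcal{A}\mathbf{x}^{k+1}+\mathcal{B}\mathbf{y}^k-c)$; - $y_j^{k+1}=\arg\min_{y_j\in\mathcal{Y}_j}\mathcal{L}_\beta(\mathbf{x}^{k+1},y_1^k,\dots,y_j,\dots,y_q^k,\lambda^{k+\frac12})+\frac{\sigma_2\beta}{2}\|B_j(y_j-y_j^k)\|^2$, for $j=1,\dots,q$; - $\lambda^{k+1}=\lambda^{k+\frac12}-s\beta(\mathcal{A}\mathbf{x}^{k+1}+\mathcal{B}\mathbf{y}^{k+1}-c)$. Put $\mathbf{w}^k=(\mathbf{x}^k,\mathbf{y}^k,\lambda^k)$. Matrices. $H_{\mathbf{x}}$ is the $p\times p$ block matrix with diagonal blocks $\sigma_1\beta A_i^{\sf T}A_i$ and off-diagonal $(i,l)$ blocks $-\beta A_i^{\sf T}A_l$. With $D_B=\mathrm{diag}(B_1^{\sf T}B_1,\dots,B_q^{\sf T}B_q)$ (block diagonal), $$Q=\begin{bmatrix}H_{\mathbf{x}}&\mathbf{0}&\mathbf{0}\\ \mathbf{0}&(\sigma_2+1)\beta D_B&-\tau\mathcal{B}^{\sf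 T}\\ \mathbf{0}&-\mathcal{B}&\frac1\beta I\end{bmatrix},\qquad M=\begin{bmatrix}I&\mathbf{0}&\mathbf{0}\\ \mathbf{0}&I&\mathbf{0}\\ \mathbf{0}&-s\beta\mathcal{B}&(\tau+s)I\end{bmatrix},$$ the blocks corresponding to $\mathbf{x},\mathbf{y},\lambda$; $H=QM^{-1}$ and $G=Q+Q^{\sf T}-M^{\sf T}Q$ (both symmetric positive definite for $(\tau,s)\in\mathcal{D}$). Solution set and distance. With $h(\mathbf{u})=\sum_{i=1}^p f_i(x_i)+\sum_{j=1}^q g_j(y_j)$ and $\mathcal{J}(\mathbf{w})=(-\mathcal{A}^{\sf T}\lambda,\,-\mathcal{B}^{\sf T}\lambda,\,\mathcal{A}\mathbf{x}+\mathcal{B}\mathbf{y}-c)$, $$\mathcal{M}^*=\bigcap_{\mathbf{w}\in\mathcal{M}}\{\widehat{\mathbf{w}}\in\mathcal{M}\mid h(\mathbf{u})-h(\widehat{\mathbf{u}})+\langle\mathbf{w}-\widehat{\mathbf{w}},\mathcal{J}(\mathbf{w})\rangle\ge 0\},$$ and $\mathrm{dist}_H(\mathbf{w},\mathcal{M}^* )=\min\{\|\mathbf{w}-\mathbf{w}^*\|_H\mid\mathbf{w}^*\in\mathcal{M}^*\}$. Constants. $\widetilde\mu_i=\lambda_{\max}(A_i^{\sf T}A_i)$, $\widetilde\nu_j=\lambda_{\max}(B_j^{\sf T}B_j)$, and $\delta=\max\{\overline\theta_i,\overline\vartheta_j,\overline\eta\mid i=1,\dots,p,\ j=1,\dots,q\}$,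 where $$\overline\theta_i=4p(1-\sigma_1)^2\beta^2\sum_{l=1}^p\widetilde\mu_l+4\beta^2\widetilde\mu_i,$$ $$\overline\vartheta_j=4q(s\beta)^2\sum_{l=1}^p\widetilde\mu_l+3q(s\beta)^2\sum_{l=1}^q\widetilde\nu_l+3(\sigma_2+1)^2\beta^2\widetilde\nu_j+2q,$$ $$\overline\eta=4(\tau+s-1)^2\sum_{l=1}^p\widetilde\mu_l+3(s-1)^2\sum_{l=1}^q\widetilde\nu_l+\frac{2}{\beta^2}.$$ The constant $\epsilon$. It is defined by $$\epsilon=\frac{\lambda_{\min}(G)}{\zeta^2\max_{i,j}\{\delta\widetilde{\mu}_i,\delta\widetilde{\nu}_j,\delta\}\,\lambda_{\max}(H)}>0,$$ the maximum being over $i=1,\dots,p$, $j=1,\dots,q$, where $\zeta>0$ is a constant such that the sequence generated by GS-ADMM satisfies $\mathrm{dist}^2_{H}(\mathbf{w}^{k+1},\mathcal{M}^* )\leq\frac{1}{1+\epsilon}\mathrm{dist}^2_{H}(\mathbf{w}^k,\mathcal{M}^* )$ for all $k$ with this $\epsilon$ (the paper proves beforehand that such a $\zeta$ exists under the assumptions of the claim).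
   Formalization: The claim C > 0 fails when the initial point w^0 already lies in M^* (then dist_H(w^0, M^* ) = 0 and C = 0); the formal statement proves C ≥ 0 always and C > 0 whenever w^0 is not in M^*. *)

theory Defs
  imports "HOL-Analysis.Analysis"
begin

section \<open>Coordinate blocks\<close>

text \<open>
  The product \<open>R^{m_1} \<times> ... \<times> R^{m_p}\<close> is the space \<open>real^'m\<close>, whose coordinates are
  distributed over the blocks by a map \<open>bl :: 'm \<Rightarrow> 'p\<close>; thus \<open>p = CARD('p)\<close> and
  \<open>m_i = card {a. bl a = i}\<close>.  The factor \<open>R^{m_i}\<close> is identified with the coordinate subspace
  \<open>block_space bl i\<close>, so that the tuple \<open>(x_1, ..., x_p)\<close> is the sum of its components.
  The column block \<open>A_i\<close> of a matrix \<open>A = [A_1, ..., A_p]\<close> is likewise \<open>A\<close> with all columns outside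
  block \<open>i\<close> replaced by zero.
\<close>

definition block_space :: "('a::finite \<Rightarrow> 'b) \<Rightarrow> 'b \<Rightarrow> (real^'a) set" where
  "block_space bl i = {v. \<forall>a. bl a \<noteq> i \<longrightarrow> v $ a = 0}"

definition block :: "('a::finite \<Rightarrow> 'b) \<Rightarrow> 'b \<Rightarrow> real^'a \<Rightarrow> real^'a" where
  "block bl i v = (\<chi> a. if bl a = i then v $ a else 0)"

definition replace_block :: "('a::finite \<Rightarrow> 'b) \<Rightarrow> 'b \<Rightarrow> real^'a \<Rightarrow> real^'a \<Rightarrow> real^'a" where
  "replace_block bl i z v = (\<chi> a. if bl a = i then z $ a else v $ a)"

definition block_cols :: "('a::finite \<Rightarrow> 'b) \<Rightarrow> 'b \<Rightarrow> real^'a^'n \<Rightarrow> real^'a^'n" where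
  "block_cols bl i A = (\<chi> r a. if bl a = i then A $ r $ a else 0)"

section \<open>Convex analysis and linear algebra\<close>

text \<open>
  The function \<open>f\<close> and its subdifferential live on a subspace \<open>E\<close> (one of the factors
  above); only the values of \<open>f\<close> on \<open>E\<close> matter.  Being real-valued on the nonempty set \<open>E\<close>,
  \<open>f\<close> is automatically proper.
\<close>

definition closed_proper_convex_on :: "'a::euclidean_space set \<Rightarrow> ('a \<Rightarrow> real) \<Rightarrow> bool" where
  "closed_proper_convex_on E f \<longleftrightarrow> convex_on E f \<and> closed (epigraph E f)"

definition subdifferential_on ::
    "'a::euclidean_space set \<Rightarrow> ('a \<Rightarrow> real) \<Rightarrow> 'a \<Rightarrow> 'a set" where
  "subdifferential_on E f x = {g. x \<in> E \<and> g \<in> E \<and> (\<forall>z\<in>E. f z \<ge> f x + g \<bullet> (z - x))}"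

definition piecewise_linear ::
    "('a::euclidean_space \<Rightarrow> 'b::euclidean_space set) \<Rightarrow> bool" where
  "piecewise_linear \<phi> \<longleftrightarrow>
     (\<exists>F. finite F \<and> (\<forall>S\<in>F. polyhedron S) \<and> {(x, y). y \<in> \<phi> x} = \<Union>F)"

text \<open>
  Eigenvalues of \<open>S\<close> as an endomorphism of the invariant subspace \<open>E\<close>; for
  \<open>S = transpose A_i ** A_i\<close> and \<open>E = block_space bl i\<close> these are the eigenvalues of the
  \<open>m_i \<times> m_i\<close> matrix.
\<close>

definition eigenvalues_on :: "(real^'a) set \<Rightarrow> real^'a^'a \<Rightarrow> real set" where
  "eigenvalues_on E S = {t. \<exists>v\<in>E. v \<noteq> 0 \<and> S *v v = t *\<^sub>R v}"

definition lambda_max_on :: "(real^'a) set \<Rightarrow> real^'a^'a \<Rightarrow> real" where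
  "lambda_max_on E S = Max (eigenvalues_on E S)"

abbreviation lambda_max :: "real^'a^'a \<Rightarrow> real" where
  "lambda_max \<equiv> lambda_max_on UNIV"

definition lambda_min :: "real^'a^'a \<Rightarrow> real" where
  "lambda_min S = Min (eigenvalues_on UNIV S)"

definition mat_norm :: "real^'a^'a \<Rightarrow> real^'a \<Rightarrow> real" where
  "mat_norm S v = sqrt (v \<bullet> (S *v v))"

definition mat_dist :: "real^'a^'a \<Rightarrow> real^'a \<Rightarrow> (real^'a) set \<Rightarrow> real" where
  "mat_dist S v C = (INF v'\<in>C. mat_norm S (v - v'))"

section \<open>Stacked vectors and block matrices\<close>

definition stack ::
    "real^'m::finite \<Rightarrow> real^'d::finite \<Rightarrow> real^'n::finite \<Rightarrow> real^('m + 'd + 'n)" where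
  "stack x y l =
     (\<chi> k. case k of Inl a \<Rightarrow> x $ a | Inr (Inl b) \<Rightarrow> y $ b | Inr (Inr e) \<Rightarrow> l $ e)"

definition x_part :: "real^('m::finite + 'd::finite + 'n::finite) \<Rightarrow> real^'m" where
  "x_part w = (\<chi> a. w $ Inl a)"

definition y_part :: "real^('m::finite + 'd::finite + 'n::finite) \<Rightarrow> real^'d" where
  "y_part w = (\<chi> b. w $ Inr (Inl b))"

definition l_part :: "real^('m::finite + 'd::finite + 'n::finite) \<Rightarrow> real^'n" where
  "l_part w = (\<chi> e. w $ Inr (Inr e))"

definition block_mat3 ::
    "real^'m::finite^'m \<Rightarrow> real^'d::finite^'m \<Rightarrow> real^'n::finite^'m \<Rightarrow>
     real^'m^'d \<Rightarrow> real^'d^'d \<Rightarrow> real^'n^'d \<Rightarrow>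
     real^'m^'n \<Rightarrow> real^'d^'n \<Rightarrow> real^'n^'n \<Rightarrow> real^('m + 'd + 'n)^('m + 'd + 'n)" where
  "block_mat3 S11 S12 S13 S21 S22 S23 S31 S32 S33 =
     (\<chi> k. case k of
         Inl a \<Rightarrow> stack (S11 $ a) (S12 $ a) (S13 $ a)
       | Inr (Inl b) \<Rightarrow> stack (S21 $ b) (S22 $ b) (S23 $ b)
       | Inr (Inr e) \<Rightarrow> stack (S31 $ e) (S32 $ e) (S33 $ e))"

section \<open>The separable convex problem\<close>

text \<open>
  \<open>Amat\<close> and \<open>Bmat\<close> are the full matrices \<open>[A_1, ..., A_p]\<close> and \<open>[B_1, ..., B_q]\<close>.
\<close>

record ('m::finite, 'd::finite, 'n::finite, 'p::finite, 'q::finite) problem =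
  xblk :: "'m \<Rightarrow> 'p"
  yblk :: "'d \<Rightarrow> 'q"
  fobj :: "'p \<Rightarrow> real^'m \<Rightarrow> real"
  gobj :: "'q \<Rightarrow> real^'d \<Rightarrow> real"
  Amat :: "real^'m^'n"
  Bmat :: "real^'d^'n"
  rhs :: "real^'n"
  Xset :: "'p \<Rightarrow> (real^'m) set"
  Yset :: "'q \<Rightarrow> (real^'d) set"

type_synonym ('m, 'd, 'n) primal_dual = "real^('m + 'd + 'n)"

context
  fixes P :: "('m::finite, 'd::finite, 'n::finite, 'p::finite, 'q::finite) problem"
begin

definition A_blk :: "'p \<Rightarrow> real^'m^'n" where
  "A_blk i = block_cols (xblk P) i (Amat P)"

definition B_blk :: "'q \<Rightarrow> real^'d^'n" where
  "B_blk j = block_cols (yblk P) j (Bmat P)"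

definition X_prod :: "(real^'m) set" where
  "X_prod = {x. \<forall>i. block (xblk P) i x \<in> Xset P i}"

definition Y_prod :: "(real^'d) set" where
  "Y_prod = {y. \<forall>j. block (yblk P) j y \<in> Yset P j}"

definition objective :: "real^'m \<Rightarrow> real^'d \<Rightarrow> real" where
  "objective x y =
     (\<Sum>i\<in>UNIV. fobj P i (block (xblk P) i x)) + (\<Sum>j\<in>UNIV. gobj P j (block (yblk P) j y))"

definition residual :: "real^'m \<Rightarrow> real^'d \<Rightarrow> real^'n" where
  "residual x y = Amat P *v x + Bmat P *v y - rhs P"

definition is_solution :: "real^'m \<Rightarrow> real^'d \<Rightarrow> bool" where
  "is_solution x y \<longleftrightarrow>
     is_arg_min (\<lambda>(x, y). objective x y)
       (\<lambda>(x, y). residual x y = 0 \<and> x \<in> X_prod \<and> y \<in> Y_prod) (x, y)"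

text \<open>
  Surjectivity of the block maps says that every factor has positive dimension; the rank
  conditions say that each \<open>A_i\<close> and \<open>B_j\<close> has as many independent columns as it has columns.
\<close>

definition standing_assumptions :: bool where
  "standing_assumptions \<longleftrightarrow>
     surj (xblk P) \<and> surj (yblk P) \<and>
     (\<forall>i. closed_proper_convex_on (block_space (xblk P) i) (fobj P i)) \<and>
     (\<forall>j. closed_proper_convex_on (block_space (yblk P) j) (gobj P j)) \<and>
     (\<forall>i. polyhedron (Xset P i) \<and> Xset P i \<subseteq> block_space (xblk P) i) \<and>
     (\<forall>j. polyhedron (Yset P j) \<and> Yset P j \<subseteq> block_space (yblk P) j) \<and>
     (\<forall>i. rank (A_blk i) = card {a. xblk P a = i}) \<and>
     (\<forall>j. rank (B_blk j) = card {b. yblk P b = j}) \<and>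
     (\<exists>x y. is_solution x y)"

definition M_set :: "('m, 'd, 'n) primal_dual set" where
  "M_set = {w. x_part w \<in> X_prod \<and> y_part w \<in> Y_prod}"

definition J_map :: "('m, 'd, 'n) primal_dual \<Rightarrow> ('m, 'd, 'n) primal_dual" where
  "J_map w =
     stack (- (transpose (Amat P) *v l_part w))
           (- (transpose (Bmat P) *v l_part w))
           (residual (x_part w) (y_part w))"

definition h_obj :: "('m, 'd, 'n) primal_dual \<Rightarrow> real" where
  "h_obj w = objective (x_part w) (y_part w)"

definition M_star :: "('m, 'd, 'n) primal_dual set" where
  "M_star = (\<Inter>w\<in>M_set. {w'\<in>M_set. h_obj w - h_obj w' + (w - w') \<bullet> J_map w \<ge> 0})"

section \<open>The method GS-ADMM\<close>

definition aug_lagrangian :: "real \<Rightarrow> real^'m \<Rightarrow> real^'d \<Rightarrow> real^'n \<Rightarrow> real" where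
  "aug_lagrangian \<beta> x y l =
     objective x y - l \<bullet> residual x y + \<beta> / 2 * (norm (residual x y))\<^sup>2"

definition gs_admm_step ::
    "real \<Rightarrow> real \<Rightarrow> real \<Rightarrow> real \<Rightarrow> real \<Rightarrow>
     ('m, 'd, 'n) primal_dual \<Rightarrow> ('m, 'd, 'n) primal_dual \<Rightarrow> bool" where
  "gs_admm_step \<beta> \<sigma>\<^sub>1 \<sigma>\<^sub>2 \<tau> s w w' \<longleftrightarrow>
     (let x = x_part w; y = y_part w; l = l_part w;
          x' = x_part w'; y' = y_part w'; l' = l_part w';
          l_half = l - (\<tau> * \<beta>) *\<^sub>R residual x' y
      in (\<forall>i. is_arg_min
                (\<lambda>z. aug_lagrangian \<beta> (replace_block (xblk P) i z x) y l
                     + \<sigma>\<^sub>1 * \<beta> / 2 * (norm (A_blk i *v (z - block (xblk P) i x)))\<^sup>2)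
                (\<lambda>z. z \<in> Xset P i) (block (xblk P) i x')) \<and>
         (\<forall>j. is_arg_min
                (\<lambda>z. aug_lagrangian \<beta> x' (replace_block (yblk P) j z y) l_half
                     + \<sigma>\<^sub>2 * \<beta> / 2 * (norm (B_blk j *v (z - block (yblk P) j y)))\<^sup>2)
                (\<lambda>z. z \<in> Yset P j) (block (yblk P) j y')) \<and>
         l' = l_half - (s * \<beta>) *\<^sub>R residual x' y')"

text \<open>The initial point \<open>w 0\<close> is arbitrary.\<close>

definition gs_admm ::
    "real \<Rightarrow> real \<Rightarrow> real \<Rightarrow> real \<Rightarrow> real \<Rightarrow> (nat \<Rightarrow> ('m, 'd, 'n) primal_dual) \<Rightarrow> bool" where
  "gs_admm \<beta> \<sigma>\<^sub>1 \<sigma>\<^sub>2 \<tau> s w \<longleftrightarrow> (\<forall>k. gs_admm_step \<beta> \<sigma>\<^sub>1 \<sigma>\<^sub>2 \<tau> s (w k) (w (Suc k)))"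

section \<open>Matrices and constants of the convergence analysis\<close>

definition Hx_mat :: "real \<Rightarrow> real \<Rightarrow> real^'m^'m" where
  "Hx_mat \<beta> \<sigma>\<^sub>1 =
     (\<Sum>i\<in>UNIV. \<Sum>l\<in>UNIV.
        if i = l then (\<sigma>\<^sub>1 * \<beta>) *\<^sub>R (transpose (A_blk i) ** A_blk i)
        else (- \<beta>) *\<^sub>R (transpose (A_blk i) ** A_blk l))"

definition D_B :: "real^'d^'d" where
  "D_B = (\<Sum>j\<in>UNIV. transpose (B_blk j) ** B_blk j)"

definition Q_mat :: "real \<Rightarrow> real \<Rightarrow> real \<Rightarrow> real \<Rightarrow> real^('m + 'd + 'n)^('m + 'd + 'n)" where
  "Q_mat \<beta> \<sigma>\<^sub>1 \<sigma>\<^sub>2 \<tau> =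
     block_mat3
       (Hx_mat \<beta> \<sigma>\<^sub>1) 0 0
       0 (((\<sigma>\<^sub>2 + 1) * \<beta>) *\<^sub>R D_B) ((- \<tau>) *\<^sub>R transpose (Bmat P))
       0 (- Bmat P) ((1 / \<beta>) *\<^sub>R mat 1)"

definition M_mat :: "real \<Rightarrow> real \<Rightarrow> real \<Rightarrow> real^('m + 'd + 'n)^('m + 'd + 'n)" where
  "M_mat \<beta> \<tau> s =
     block_mat3
       (mat 1) 0 0
       0 (mat 1) 0
       0 ((- (s * \<beta>)) *\<^sub>R Bmat P) ((\<tau> + s) *\<^sub>R mat 1)"

definition H_mat ::
    "real \<Rightarrow> real \<Rightarrow> real \<Rightarrow> real \<Rightarrow> real \<Rightarrow> real^('m + 'd + 'n)^('m + 'd + 'n)" where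
  "H_mat \<beta> \<sigma>\<^sub>1 \<sigma>\<^sub>2 \<tau> s = Q_mat \<beta> \<sigma>\<^sub>1 \<sigma>\<^sub>2 \<tau> ** matrix_inv (M_mat \<beta> \<tau> s)"

definition G_mat ::
    "real \<Rightarrow> real \<Rightarrow> real \<Rightarrow> real \<Rightarrow> real \<Rightarrow> real^('m + 'd + 'n)^('m + 'd + 'n)" where
  "G_mat \<beta> \<sigma>\<^sub>1 \<sigma>\<^sub>2 \<tau> s =
     Q_mat \<beta> \<sigma>\<^sub>1 \<sigma>\<^sub>2 \<tau> + transpose (Q_mat \<beta> \<sigma>\<^sub>1 \<sigma>\<^sub>2 \<tau>)
     - transpose (M_mat \<beta> \<tau> s) ** Q_mat \<beta> \<sigma>\<^sub>1 \<sigma>\<^sub>2 \<tau>"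

definition mu :: "'p \<Rightarrow> real" where
  "mu i = lambda_max_on (block_space (xblk P) i) (transpose (A_blk i) ** A_blk i)"

definition nu :: "'q \<Rightarrow> real" where
  "nu j = lambda_max_on (block_space (yblk P) j) (transpose (B_blk j) ** B_blk j)"

definition theta_bar :: "real \<Rightarrow> real \<Rightarrow> 'p \<Rightarrow> real" where
  "theta_bar \<beta> \<sigma>\<^sub>1 i =
     4 * real CARD('p) * (1 - \<sigma>\<^sub>1)\<^sup>2 * \<beta>\<^sup>2 * (\<Sum>l\<in>UNIV. mu l) + 4 * \<beta>\<^sup>2 * mu i"

definition vartheta_bar :: "real \<Rightarrow> real \<Rightarrow> real \<Rightarrow> 'q \<Rightarrow> real" where
  "vartheta_bar \<beta> \<sigma>\<^sub>2 s j =
     4 * real CARD('q) * (s * \<beta>)\<^sup>2 * (\<Sum>l\<in>UNIV. mu l)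
     + 3 * real CARD('q) * (s * \<beta>)\<^sup>2 * (\<Sum>l\<in>UNIV. nu l)
     + 3 * (\<sigma>\<^sub>2 + 1)\<^sup>2 * \<beta>\<^sup>2 * nu j + 2 * real CARD('q)"

definition eta_bar :: "real \<Rightarrow> real \<Rightarrow> real \<Rightarrow> real" where
  "eta_bar \<beta> \<tau> s =
     4 * (\<tau> + s - 1)\<^sup>2 * (\<Sum>l\<in>UNIV. mu l) + 3 * (s - 1)\<^sup>2 * (\<Sum>l\<in>UNIV. nu l) + 2 / \<beta>\<^sup>2"

definition delta :: "real \<Rightarrow> real \<Rightarrow> real \<Rightarrow> real \<Rightarrow> real \<Rightarrow> real" where
  "delta \<beta> \<sigma>\<^sub>1 \<sigma>\<^sub>2 \<tau> s =
     Max (range (theta_bar \<beta> \<sigma>\<^sub>1) \<union> range (vartheta_bar \<beta> \<sigma>\<^sub>2 s) \<union> {eta_bar \<beta> \<tau> s})"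

definition epsilon :: "real \<Rightarrow> real \<Rightarrow> real \<Rightarrow> real \<Rightarrow> real \<Rightarrow> real \<Rightarrow> real" where
  "epsilon \<beta> \<sigma>\<^sub>1 \<sigma>\<^sub>2 \<tau> s \<zeta> =
     (let \<delta> = delta \<beta> \<sigma>\<^sub>1 \<sigma>\<^sub>2 \<tau> s
      in lambda_min (G_mat \<beta> \<sigma>\<^sub>1 \<sigma>\<^sub>2 \<tau> s) /
         (\<zeta>\<^sup>2 * Max (range (\<lambda>i. \<delta> * mu i) \<union> range (\<lambda>j. \<delta> * nu j) \<union> {\<delta>})
          * lambda_max (H_mat \<beta> \<sigma>\<^sub>1 \<sigma>\<^sub>2 \<tau> s)))"

end

definition stepsize_region :: "(real \<times> real) set" where
  "stepsize_region = {(\<tau>, s). \<tau> < 1 \<and> s < 1 \<and> \<tau> + s > 0}"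

end

theory Submission
  imports Defs
begin

text \<open>
  One step of the method is a prediction \<open>p\<close> followed by the correction \<open>w' = w - M (w - p)\<close>.
  The optimality conditions of the subproblems say that \<open>p\<close> solves the variational inequality of
  \<open>M_star\<close> up to the perturbation \<open>Q (p - w)\<close>; testing it with \<open>v \<in> M_star\<close> and using \<open>Q = H M\<close>
  gives \<open>|w' - v|_H^2 \<le> |w - v|_H^2 - |w - p|_G^2\<close>.  Hence each step has \<open>H\<close>-length at most twice
  the distance of \<open>w\<close> to \<open>M_star\<close>, and since these distances contract by the factor \<open>r\<close>, the steps
  are dominated by a geometric series whose limit lies in the closed set \<open>M_star\<close>.
  That \<open>M_star\<close> is nonempty is strong duality for a convex objective finite everywhere under
  polyhedral constraints.
\<close>

section \<open>Multipliers for polyhedral convex programs\<close>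

text \<open>The contraction of the distances is the hypothesis on \<open>\<zeta>\<close>. What must
  be supplied is whatever turns it into convergence to a single point: monotonicity towards every
  point of \<open>M_star\<close>, closedness of \<open>M_star\<close>, and nonemptiness, without
  which the infimum in \<open>mat_dist\<close> carries no information. Only a primal solution is
  assumed, so the multiplier component has to be constructed, and no Slater point is available. The
  construction therefore has two stages: separation of an epigraph replaces the objective by one of
  its subgradients, and a Farkas argument with a finitely generated cone treats the resulting linear
  objective. The matrix \<open>Q\<close> is not symmetric and \<open>H\<close> is defined through an
  inverse. Both difficulties vanish on vectors \<open>M v\<close>, where the form of
  \<open>H\<close> becomes that of \<open>transpose M ** Q\<close>, which is symmetric. The lower
  bounds on \<open>\<sigma>\<^sub>1\<close> and \<open>\<sigma>\<^sub>2\<close> and the stepsize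
  region make the forms of \<open>H\<close> and \<open>G\<close> sums of nonnegative terms.\<close>

lemma polyhedron_linear_vimage:
  fixes f :: "'a::euclidean_space \<Rightarrow> 'b::euclidean_space"
  assumes "linear f" "polyhedron S"
  shows "polyhedron (f -` S)"
proof -
  obtain F where F: "finite F" "S = \<Inter>F" "\<forall>h\<in>F. \<exists>a b. a \<noteq> 0 \<and> h = {x. a \<bullet> x \<le> b}"
    using assms(2) unfolding polyhedron_def by blast
  have "polyhedron (f -` h)" if "h \<in> F" for h
  proof -
    obtain a b where h: "h = {x. a \<bullet> x \<le> b}" using F(3) \<open>h \<in> F\<close> by blast
    \<comment> \<open>The new normal \<open>adjoint f a\<close> may be zero; the preimage is then
      empty or the whole space, which still counts as a polyhedron.\<close>
    have "f -` h = {x. adjoint f a \<bullet> x \<le> b}"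
      unfolding h using adjoint_works[OF assms(1)] by (auto simp: inner_commute)
    then show ?thesis by (simp add: polyhedron_halfspace_le)
  qed
  moreover have "f -` S = \<Inter>((-`) f ` F)" using F(2) by auto
  ultimately show ?thesis using F(1) by auto
qed

lemma polyhedron_finite_halfspaces:
  fixes S :: "'a::euclidean_space set"
  assumes "polyhedron S"
  obtains I where "finite I" "S = {x. \<forall>(a, b)\<in>I. a \<bullet> x \<le> b}"
proof -
  obtain F where F: "finite F" "S = \<Inter>F" "\<forall>h\<in>F. \<exists>a b. a \<noteq> 0 \<and> h = {x. a \<bullet> x \<le> b}"
    using assms unfolding polyhedron_def by blast
  then obtain a b where ab: "\<And>h. h \<in> F \<Longrightarrow> h = {x. a h \<bullet> x \<le> b h}" by metis
  have "S = {x. \<forall>(a, b)\<in>(\<lambda>h. (a h, b h)) ` F. a \<bullet> x \<le> b}"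
    unfolding F(2) using ab by auto
  then show ?thesis using that F(1) by blast
qed

text \<open>Active constraints persist for every positive \<open>t\<close> because \<open>d\<close>
  does not increase them; inactive ones have slack and persist for small \<open>t\<close> by
  continuity. Finiteness of \<open>I\<close> gives a common \<open>t\<close>.\<close>

lemma polyhedron_feasible_direction:
  fixes u d :: "'a::euclidean_space"
  assumes "finite I" "\<And>a b. (a, b) \<in> I \<Longrightarrow> a \<bullet> u \<le> b"
    and "\<And>a b. (a, b) \<in> I \<Longrightarrow> a \<bullet> u = b \<Longrightarrow> a \<bullet> d \<le> 0"
  obtains t where "t > 0" "\<And>a b. (a, b) \<in> I \<Longrightarrow> a \<bullet> (u + t *\<^sub>R d) \<le> b"
proof -
  have "\<forall>\<^sub>F t in at_right 0. case i of (a, b) \<Rightarrow> a \<bullet> (u + t *\<^sub>R d) \<le> b" if "i \<in> I" for i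
  proof (cases i)
    case (Pair a b)
    show ?thesis
    proof (cases "a \<bullet> u = b")
      case True
      then have "a \<bullet> d \<le> 0" using assms(3) Pair that by blast
      then have "t > 0 \<Longrightarrow> a \<bullet> (u + t *\<^sub>R d) \<le> b" for t
        using True by (simp add: inner_add_right mult_nonneg_nonpos)
      then show ?thesis using Pair by (auto simp: eventually_at_right_less eventually_at_filter)
    next
      case False
      then have "a \<bullet> u < b" using assms(2) Pair that by fastforce
      moreover have "((\<lambda>t. a \<bullet> (u + t *\<^sub>R d)) \<longlongrightarrow> a \<bullet> (u + 0 *\<^sub>R d)) (at_right 0)"
        by (intro tendsto_intros)
      ultimately have "\<forall>\<^sub>F t in at_right 0. a \<bullet> (u + t *\<^sub>R d) < b"
        by (intro order_tendstoD(2)) auto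
      then show ?thesis using Pair by (auto elim: eventually_mono)
    qed
  qed
  then have "\<forall>\<^sub>F t in at_right (0::real). \<forall>i\<in>I. case i of (a, b) \<Rightarrow> a \<bullet> (u + t *\<^sub>R d) \<le> b"
    by (simp add: eventually_ball_finite assms(1))
  moreover have "\<forall>\<^sub>F t in at_right (0::real). t > 0" by (simp add: eventually_at_right_less)
  ultimately have "\<forall>\<^sub>F t in at_right (0::real). t > 0 \<and> (\<forall>i\<in>I. case i of (a, b) \<Rightarrow> a \<bullet> (u + t *\<^sub>R d) \<le> b)"
    by eventually_elim auto
  then obtain t::real where "t > 0" "\<forall>i\<in>I. case i of (a, b) \<Rightarrow> a \<bullet> (u + t *\<^sub>R d) \<le> b"
    using eventually_happens' trivial_limit_at_right_real by blast
  then show ?thesis using that by blast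
qed

text \<open>Farkas: \<open>a\<close> must lie in the cone \<open>W\<close> spanned by the normals
  active at \<open>u\<close> and the range of \<open>adjoint K\<close>. Otherwise a separating
  \<open>d\<close> satisfies \<open>K d = 0\<close>, and \<open>- d\<close> is a feasible direction
  along which \<open>a\<close> increases strictly. Membership in \<open>W\<close> yields the
  multiplier, since the functionals that admit one form a convex cone \<open>V\<close> containing
  all generators.\<close>

lemma polyhedron_linear_multiplier:
  fixes K :: "'a::euclidean_space \<Rightarrow> 'b::euclidean_space"
  assumes "polyhedron S" "linear K" "u \<in> S"
    and max: "\<And>p. p \<in> S \<Longrightarrow> K p = K u \<Longrightarrow> a \<bullet> p \<le> a \<bullet> u"
  obtains l where "\<And>v. v \<in> S \<Longrightarrow> a \<bullet> (v - u) \<le> l \<bullet> (K v - K u)"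
proof -
  obtain I where I: "finite I" "S = {x. \<forall>(a, b)\<in>I. a \<bullet> x \<le> b}"
    using polyhedron_finite_halfspaces[OF assms(1)] by blast
  define N where "N = {n \<in> fst ` I. (n, n \<bullet> u) \<in> I}"
  \<comment> \<open>Basis vectors with both signs generate the range of \<open>adjoint K\<close> as
    a cone; finitely many generators make \<open>W\<close> closed.\<close>
  define W where "W = convex_cone hull (N \<union> adjoint K ` (Basis \<union> uminus ` Basis))"
  define V where "V = {n. \<exists>l. \<forall>v\<in>S. n \<bullet> (v - u) \<le> l \<bullet> (K v - K u)}"
  have "a \<in> W"
  proof (rule ccontr)
    assume "a \<notin> W"
    have cone: "convex_cone W" unfolding W_def by (rule convex_cone_convex_cone_hull)
    have "closed W" unfolding W_def N_def using I(1) by (intro closed_convex_cone_hull) auto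
    then obtain d b where d: "d \<bullet> a < b" "\<forall>x\<in>W. d \<bullet> x > b"
      using separating_hyperplane_closed_point[of W a] \<open>a \<notin> W\<close> cone
      unfolding convex_cone_def by blast
    have "b < 0" using d(2) convex_cone_contains_0[OF cone] by force
    \<comment> \<open>On a cone the separating level \<open>b < 0\<close> improves to 0: a vector
      with negative value could be rescaled to have value exactly \<open>b\<close>.\<close>
    have pos: "d \<bullet> x \<ge> 0" if "x \<in> W" for x
    proof (rule ccontr)
      assume "\<not> 0 \<le> d \<bullet> x"
      then have "d \<bullet> ((b / (d \<bullet> x)) *\<^sub>R x) = b" by simp
      moreover have "(b / (d \<bullet> x)) *\<^sub>R x \<in> W"
        using \<open>\<not> 0 \<le> d \<bullet> x\<close> \<open>b < 0\<close> that cone by (simp add: convex_cone_scaleR zero_le_divide_iff)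
      ultimately show False using d(2) by force
    qed
    have gen: "N \<union> adjoint K ` (Basis \<union> uminus ` Basis) \<subseteq> W"
      unfolding W_def by (rule hull_subset)
    have "K d \<bullet> i = 0" if "i \<in> Basis" for i
    proof -
      have "adjoint K i \<in> W" "adjoint K (- i) \<in> W" using gen that by blast+
      then have "d \<bullet> adjoint K i \<ge> 0" "d \<bullet> adjoint K (- i) \<ge> 0" using pos by blast+
      then show ?thesis by (simp add: adjoint_works[OF assms(2)])
    qed
    then have Kd: "K d = 0" using euclidean_all_zero_iff by blast
    have "n \<bullet> (- d) \<le> 0" if "(n, b) \<in> I" "n \<bullet> u = b" for n b
    proof -
      have "n \<in> N" using that by (force simp: N_def)
      then show ?thesis using gen pos[of n] by (auto simp: inner_commute)
    qed
    moreover have "n \<bullet> u \<le> b" if "(n, b) \<in> I" for n b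
      using I(2) assms(3) that by blast
    ultimately obtain t where "t > 0" "\<And>n b. (n, b) \<in> I \<Longrightarrow> n \<bullet> (u + t *\<^sub>R (- d)) \<le> b"
      using polyhedron_feasible_direction[of I u "- d"] I(1) by blast
    then have "u + t *\<^sub>R (- d) \<in> S" using I(2) by blast
    moreover have "K (u + t *\<^sub>R (- d)) = K u"
      using Kd assms(2) by (simp add: linear_add linear_cmul linear_neg linear_diff)
    ultimately have "a \<bullet> (u + t *\<^sub>R (- d)) \<le> a \<bullet> u" by (rule max)
    then have "d \<bullet> a \<ge> 0" using \<open>t > 0\<close>
      by (simp add: inner_diff_right inner_commute zero_le_mult_iff)
    then show False using d(1) \<open>b < 0\<close> by simp
  qed
  moreover have "W \<subseteq> V" unfolding W_def
  proof (rule hull_minimal)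
    have "n \<in> V" if "n \<in> N" for n
      using that I(2) unfolding N_def V_def
      by (auto intro!: exI[of _ 0] simp: inner_diff_right)
    moreover have "adjoint K y \<in> V" for y
      unfolding V_def using assms(2)
      using adjoint_works[OF assms(2)] by (auto intro!: exI[of _ y] simp: inner_commute linear_diff)
    ultimately show "N \<union> adjoint K ` (Basis \<union> uminus ` Basis) \<subseteq> V" by blast
    show "convex_cone V" unfolding convex_cone_iff
    proof (intro conjI ballI allI impI)
      show "0 \<in> V" unfolding V_def by (auto intro!: exI[of _ 0])
    next
      fix x y assume "x \<in> V" "y \<in> V"
      then obtain l l' where "\<forall>v\<in>S. x \<bullet> (v - u) \<le> l \<bullet> (K v - K u)" "\<forall>v\<in>S. y \<bullet> (v - u) \<le> l' \<bullet> (K v - K u)"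
        unfolding V_def by blast
      then have "\<forall>v\<in>S. (x + y) \<bullet> (v - u) \<le> (l + l') \<bullet> (K v - K u)"
        by (simp add: inner_add_left add_mono)
      then show "x + y \<in> V" unfolding V_def by blast
    next
      fix x and c :: real assume "x \<in> V" "0 \<le> c"
      then obtain l where "\<forall>v\<in>S. x \<bullet> (v - u) \<le> l \<bullet> (K v - K u)"
        unfolding V_def by blast
      then have "\<forall>v\<in>S. (c *\<^sub>R x) \<bullet> (v - u) \<le> (c *\<^sub>R l) \<bullet> (K v - K u)"
        using \<open>0 \<le> c\<close> by (simp add: mult_left_mono)
      then show "c *\<^sub>R x \<in> V" unfolding V_def by blast
    qed
  qed
  ultimately show ?thesis using that unfolding V_def by blast
qed

text \<open>The optimality condition that some subgradient of \<open>h\<close> at \<open>u\<close>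
  is the negative of a normal to \<open>S\<close>. It comes from separating the strict epigraph of
  \<open>h\<close> from \<open>S \<times> {..h u}\<close>: the slope of the hyperplane is the
  subgradient, provided the hyperplane is not vertical.\<close>

lemma convex_minimizer_subgradient:
  fixes h :: "'a::euclidean_space \<Rightarrow> real"
  assumes h: "convex_on UNIV h" and "convex S" "u \<in> S" and min: "\<And>p. p \<in> S \<Longrightarrow> h u \<le> h p"
  obtains a where "\<And>v. h u + a \<bullet> (v - u) \<le> h v" "\<And>p. p \<in> S \<Longrightarrow> 0 \<le> a \<bullet> (p - u)"
proof -
  define U where "U = {(v, t). h v < t}"
  define T where "T = S \<times> {..h u}"
  have "convex U" unfolding U_def
  proof (rule convexI, clarsimp)
    fix x y :: 'a and s t \<mu> \<nu> :: real
    assume *: "h x < s" "h y < t" "0 \<le> \<mu>" "0 \<le> \<nu>" "\<mu> + \<nu> = 1"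
    then have "h (\<mu> *\<^sub>R x + \<nu> *\<^sub>R y) \<le> \<mu> * h x + \<nu> * h y"
      using h unfolding convex_on_def by auto
    also have "\<dots> < \<mu> * s + \<nu> * t"
    proof (cases "\<mu> = 0")
      case True then show ?thesis using * by simp
    next
      case False
      then show ?thesis using * by (intro add_less_le_mono mult_strict_left_mono mult_left_mono) auto
    qed
    finally show "h (\<mu> *\<^sub>R x + \<nu> *\<^sub>R y) < \<mu> * s + \<nu> * t" .
  qed
  moreover have "convex T" unfolding T_def using assms(2) by (intro convex_Times) auto
  moreover have "(u, h u + 1) \<in> U" "(u, h u) \<in> T" unfolding U_def T_def using assms(3) by auto
  moreover have "U \<inter> T = {}" unfolding U_def T_def using min by force
  ultimately obtain z \<gamma> where z: "z \<noteq> 0" "\<forall>x\<in>U. z \<bullet> x \<le> \<gamma>" "\<forall>x\<in>T. \<gamma> \<le> z \<bullet> x"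
    using separating_hyperplane_sets[of U T] by blast
  obtain a b where ab: "z = (a, b)" by (cases z)
  have le: "a \<bullet> v + b * t \<le> \<gamma>" if "h v < t" for v t
    using z(2) that unfolding U_def ab by auto
  have ge: "\<gamma> \<le> a \<bullet> p + b * t" if "p \<in> S" "t \<le> h u" for p t
    using z(3) that unfolding T_def ab by auto
  have "b \<le> 0" using le[of u "h u + 1"] ge[of u "h u"] assms(3) by (simp add: algebra_simps)
  \<comment> \<open>Finiteness of \<open>h\<close> on the whole space excludes a vertical
    hyperplane: \<open>a\<close> would be bounded above everywhere by its value at \<open>u\<close>,
    and testing at \<open>u + a\<close> forces \<open>a = 0\<close>.\<close>
  moreover have "b \<noteq> 0"
  proof
    assume "b = 0"
    then have "a \<bullet> v \<le> \<gamma>" for v using le[of v "h v + 1"] by simp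
    moreover have "\<gamma> \<le> a \<bullet> u" using ge[of u "h u"] \<open>b = 0\<close> assms(3) by simp
    ultimately have "a \<bullet> (u + a) \<le> a \<bullet> u" using order_trans by blast
    then have "a = 0" by (simp add: inner_add_right flip: power2_norm_eq_inner)
    then show False using z(1) ab \<open>b = 0\<close> by (simp add: zero_prod_def)
  qed
  ultimately have b: "b < 0" by simp
  have le': "a \<bullet> v + b * h v \<le> \<gamma>" for v
  proof (rule tendsto_upperbound)
    show "((\<lambda>t. a \<bullet> v + b * t) \<longlongrightarrow> a \<bullet> v + b * h v) (at_right (h v))"
      by (intro tendsto_intros)
    show "\<forall>\<^sub>F t in at_right (h v). a \<bullet> v + b * t \<le> \<gamma>"
      using le eventually_at_right_less[of "h v"] by (auto elim: eventually_mono)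
  qed simp
  have eq: "\<gamma> = a \<bullet> u + b * h u" using le'[of u] ge[of u "h u"] assms(3) by simp
  show ?thesis
  proof (rule that[of "(- 1 / b) *\<^sub>R a"])
    fix v
    have "a \<bullet> (v - u) \<le> - b * (h v - h u)" using le'[of v] eq by (simp add: algebra_simps)
    then show "h u + (- 1 / b) *\<^sub>R a \<bullet> (v - u) \<le> h v" using b by (simp add: field_simps)
  next
    fix p assume "p \<in> S"
    then have "0 \<le> a \<bullet> (p - u)" using ge[of p "h u"] eq by (simp add: inner_diff_right)
    then show "0 \<le> (- 1 / b) *\<^sub>R a \<bullet> (p - u)" using b by (simp add: zero_le_divide_iff mult_le_0_iff divide_le_0_iff)
  qed
qed

text \<open>No constraint qualification is needed: \<open>h\<close> is finite everywhere and all constraints are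
  polyhedral.\<close>

lemma convex_polyhedral_multiplier:
  fixes h :: "'a::euclidean_space \<Rightarrow> real" and K :: "'a \<Rightarrow> 'b::euclidean_space"
  assumes "convex_on UNIV h" "polyhedron S" "linear K" "u \<in> S"
    and min: "\<And>p. p \<in> S \<Longrightarrow> K p = K u \<Longrightarrow> h u \<le> h p"
  obtains l where "\<And>v. v \<in> S \<Longrightarrow> h u + l \<bullet> (K v - K u) \<le> h v"
proof -
  have "convex (S \<inter> K -` {K u})"
    using assms(2,3) by (simp add: convex_Int convex_linear_vimage polyhedron_imp_convex)
  then obtain a where a: "\<And>v. h u + a \<bullet> (v - u) \<le> h v"
    "\<And>p. p \<in> S \<inter> K -` {K u} \<Longrightarrow> 0 \<le> a \<bullet> (p - u)"
    using convex_minimizer_subgradient[of h "S \<inter> K -` {K u}" u] assms by auto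
  \<comment> \<open>From here on \<open>h\<close> is replaced by its linear minorant at
    \<open>u\<close>, which is still minimal at \<open>u\<close> on the fibre of \<open>K\<close>;
    the sign changes because the linear result is stated for maximizers.\<close>
  have "- a \<bullet> p \<le> - a \<bullet> u" if "p \<in> S" "K p = K u" for p
    using a(2)[of p] that by (simp add: inner_diff_right)
  then obtain l where l: "\<And>v. v \<in> S \<Longrightarrow> - a \<bullet> (v - u) \<le> l \<bullet> (K v - K u)"
    using polyhedron_linear_multiplier[of S K u "- a"] assms by blast
  show ?thesis
  proof (rule that[of "- l"])
    fix v assume "v \<in> S"
    then show "h u + - l \<bullet> (K v - K u) \<le> h v" using a(1)[of v] l[of v] by simp
  qed
qed

section \<open>Variational inequalities for proximal minimizers\<close>

text \<open>Moving from \<open>x\<close> a fraction \<open>t\<close> towards \<open>z\<close>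
  changes \<open>\<phi>\<close> by at most \<open>t * (\<phi> z - \<phi> x)\<close> and
  \<open>q\<close> by \<open>t * D + t\<^sup>2 * E\<close>. Division by \<open>t\<close> and the
  limit at 0 leave the directional derivative \<open>D\<close> of \<open>q\<close>, without any
  differentiability of \<open>\<phi>\<close>.\<close>

lemma convex_plus_quadratic_minimizer:
  fixes \<phi> :: "'a::real_vector \<Rightarrow> real"
  assumes "convex_on S \<phi>" "x \<in> S" "z \<in> S"
    and min: "\<And>y. y \<in> S \<Longrightarrow> \<phi> x + q x \<le> \<phi> y + q y"
    and q: "\<And>t. q (x + t *\<^sub>R (z - x)) = q x + t * D + t\<^sup>2 * E"
  shows "0 \<le> \<phi> z - \<phi> x + D"
proof (rule tendsto_lowerbound)
  show "((\<lambda>t. \<phi> z - \<phi> x + D + t * E) \<longlongrightarrow> \<phi> z - \<phi> x + D) (at_right 0)"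
    by (rule tendsto_eq_intros | simp)+
  have "0 \<le> \<phi> z - \<phi> x + D + t * E" if "0 < t" "t < 1" for t
  proof -
    have *: "x + t *\<^sub>R (z - x) = (1 - t) *\<^sub>R x + t *\<^sub>R z" by (simp add: algebra_simps)
    have "convex S" using assms(1) convex_on_imp_convex by blast
    then have "x + t *\<^sub>R (z - x) \<in> S" unfolding * using assms that by (intro convexD) auto
    then have "\<phi> x + q x \<le> \<phi> (x + t *\<^sub>R (z - x)) + q (x + t *\<^sub>R (z - x))" by (rule min)
    also have "\<phi> (x + t *\<^sub>R (z - x)) \<le> (1 - t) * \<phi> x + t * \<phi> z"
      unfolding * using assms that by (intro convex_onD) auto
    finally have "0 \<le> t * (\<phi> z - \<phi> x + D + t * E)"
      unfolding q by (simp add: algebra_simps power2_eq_square)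
    then show ?thesis using that by (simp add: zero_le_mult_iff)
  qed
  then show "\<forall>\<^sub>F t in at_right 0. 0 \<le> \<phi> z - \<phi> x + D + t * E"
    by (intro eventually_at_rightI[of 0 1]) auto
qed simp

lemma convex_on_linear_vimage:
  assumes "convex_on E f" "linear L" "\<And>w. L w \<in> E"
  shows "convex_on UNIV (\<lambda>w. f (L w))"
proof (rule convex_onI)
  fix t :: real and x y assume "0 < t" "t < 1"
  then show "f (L ((1 - t) *\<^sub>R x + t *\<^sub>R y)) \<le> (1 - t) * f (L x) + t * f (L y)"
    using assms by (simp add: linear_add linear_scale convex_onD)
qed simp

lemma convex_on_sum_functions:
  assumes "finite I" "convex S" "\<And>i. i \<in> I \<Longrightarrow> convex_on S (f i)"
  shows "convex_on S (\<lambda>w. \<Sum>i\<in>I. f i w)"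
  using assms by (induction I rule: finite_induct) (auto intro: convex_on_add simp: convex_on_const)

text \<open>\<open>L\<close> is the block of the constraint matrix being updated, \<open>R\<close> the residual before the
  update, and \<open>x0\<close> the proximal centre.\<close>

lemma proximal_minimizer_variational_inequality:
  fixes L :: "'a::real_vector \<Rightarrow> 'b::real_inner"
  assumes "convex_on S f" "x \<in> S" "z \<in> S" "linear L"
    and min: "\<And>y. y \<in> S \<Longrightarrow>
      f x - l \<bullet> (R + L (x - x0)) + \<beta> / 2 * (norm (R + L (x - x0)))\<^sup>2 + \<sigma> * \<beta> / 2 * (norm (L (x - x0)))\<^sup>2
      \<le> f y - l \<bullet> (R + L (y - x0)) + \<beta> / 2 * (norm (R + L (y - x0)))\<^sup>2 + \<sigma> * \<beta> / 2 * (norm (L (y - x0)))\<^sup>2"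
  shows "0 \<le> f z - f x + L (z - x) \<bullet> (\<beta> *\<^sub>R R - l) + (\<sigma> + 1) * \<beta> * (L (z - x) \<bullet> L (x - x0))"
proof -
  define q where "q y = - l \<bullet> (R + L (y - x0)) + \<beta> / 2 * (norm (R + L (y - x0)))\<^sup>2
      + \<sigma> * \<beta> / 2 * (norm (L (y - x0)))\<^sup>2" for y
  define b where "b = L (z - x)"
  \<comment> \<open>The penalty contributes \<open>\<beta>\<close> and the proximal term
    \<open>\<sigma> * \<beta>\<close> to the coefficient of \<open>b \<bullet> L (x - x0)\<close>;
    hence the factor \<open>\<sigma> + 1\<close>.\<close>
  have q: "q (x + t *\<^sub>R (z - x)) = q x
      + t * (b \<bullet> (\<beta> *\<^sub>R R - l) + (\<sigma> + 1) * \<beta> * (b \<bullet> L (x - x0)))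
      + t\<^sup>2 * ((\<sigma> + 1) * \<beta> / 2 * (b \<bullet> b))" for t
  proof -
    have "x + t *\<^sub>R (z - x) - x0 = (x - x0) + t *\<^sub>R (z - x)" by simp
    then have L: "L (x + t *\<^sub>R (z - x) - x0) = L (x - x0) + t *\<^sub>R b"
      using \<open>linear L\<close> by (simp only: linear_add linear_scale b_def)
    show ?thesis unfolding q_def L power2_norm_eq_inner
      by (simp add: inner_add_left inner_add_right inner_diff_right inner_commute
          power2_eq_square algebra_simps add_divide_distrib)
  qed
  have min': "f x + q x \<le> f y + q y" if "y \<in> S" for y
    using min[OF that] unfolding q_def by simp
  show ?thesis
    using convex_plus_quadratic_minimizer[OF assms(1-3) min' q] unfolding b_def by simp
qed

section \<open>Symmetric positive definite matrices\<close>

lemma inner_transpose_mult_vec: "x \<bullet> (transpose A *v y) = (A *v x) \<bullet> (y :: real^_)"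
  by (simp add: inner_commute[of x] dot_lmul_matrix) (simp add: inner_commute)

lemma inner_gram: "v \<bullet> ((transpose A ** B) *v w) = (A *v v) \<bullet> ((B *v w) :: real^_)"
  by (simp only: inner_transpose_mult_vec flip: matrix_vector_mul_assoc)

lemma sum_mult_vec: "(\<Sum>i\<in>I. A i) *v v = (\<Sum>i\<in>I. A i *v v)"
  by (induction I rule: infinite_finite_induct) (auto simp: matrix_vector_mult_add_rdistrib)

lemma uminus_mult_vec: "(- S) *v w = - (S *v (w :: real^_))"
  using matrix_vector_mult_diff_rdistrib[of 0 S w] by simp

lemma matrix_inv_inverse:
  assumes "invertible S"
  shows "S ** matrix_inv S = mat 1" "matrix_inv S ** S = mat 1"
  using someI_ex[OF assms[unfolded invertible_def]] by (simp_all add: matrix_inv_def)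

lemma symmetric_matrixI:
  fixes S :: "real^'k^'k"
  assumes "\<And>v w. v \<bullet> (S *v w) = w \<bullet> (S *v v)" shows "transpose S = S"
proof -
  have "v \<bullet> (transpose S *v w - S *v w) = 0" for v w
    using assms[of v w] by (simp add: inner_diff_right inner_transpose_mult_vec inner_commute
        del: transpose_matrix_vector)
  then show ?thesis by (metis inner_eq_zero_iff matrix_eq right_minus_eq)
qed

section \<open>Extremal eigenvalues of symmetric matrices\<close>

lemma quadratic_nonneg_imp_linear_zero:
  fixes a b :: real
  assumes "\<And>t. 0 \<le> a * t + b * t\<^sup>2"
  shows "a = 0"
proof (rule ccontr)
  assume "a \<noteq> 0"
  define B where "B = \<bar>b\<bar> + 1"
  have B: "B > 0" "b < B" by (auto simp: B_def)
  have "0 \<le> a * (- a / B) + b * (- a / B)\<^sup>2" by (rule assms)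
  also have "\<dots> = a\<^sup>2 * (b - B) / B\<^sup>2" using B by (simp add: field_simps power2_eq_square)
  also have "\<dots> < 0" using B \<open>a \<noteq> 0\<close> by (intro divide_neg_pos mult_pos_neg) auto
  finally show False by simp
qed

lemma symmetric_matrix_inner:
  fixes S :: "real^'a^'a"
  assumes "transpose S = S"
  shows "x \<bullet> (S *v y) = y \<bullet> (S *v x)"
  by (metis assms dot_lmul_matrix inner_commute vector_transpose_matrix)

text \<open>A maximizer \<open>v\<close> of the Rayleigh quotient on the unit sphere of
  \<open>E\<close> is an eigenvector: the first-order condition makes
  \<open>t *\<^sub>R v - S *v v\<close> orthogonal to \<open>E\<close>, and invariance puts this
  vector into \<open>E\<close>, so it vanishes. Together with finiteness this gives meaning to
  \<open>Max\<close> and \<open>Min\<close> in the extremal eigenvalues.\<close>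

lemma symmetric_matrix_eigenvalue_exists:
  fixes S :: "real^'a^'a"
  assumes S: "transpose S = S" and E: "subspace E" "E \<noteq> {0}"
    and inv: "\<And>v. v \<in> E \<Longrightarrow> S *v v \<in> E"
  shows "eigenvalues_on E S \<noteq> {}"
proof -
  let ?K = "E \<inter> sphere 0 1"
  have "compact ?K" using closed_subspace[OF E(1)] by (simp add: closed_Int_compact)
  moreover obtain e where "e \<in> E" "e \<noteq> 0" using E subspace_0 by blast
  then have "(1 / norm e) *\<^sub>R e \<in> ?K" using E(1) by (auto simp: subspace_scale)
  moreover have "continuous_on ?K (\<lambda>v. v \<bullet> (S *v v))"
    by (intro continuous_on_inner continuous_on_id linear_continuous_on_compose[OF _ matrix_vector_mul_linear])
  ultimately obtain v where v: "v \<in> ?K" and max: "\<forall>w\<in>?K. w \<bullet> (S *v w) \<le> v \<bullet> (S *v v)"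
    using continuous_attains_sup[of ?K "\<lambda>v. v \<bullet> (S *v v)"] by blast
  define t where "t = v \<bullet> (S *v v)"
  have form: "w \<bullet> (S *v w) \<le> t * (w \<bullet> w)" if "w \<in> E" for w
  proof (cases "w = 0")
    case False
    have "(1 / norm w) *\<^sub>R w \<in> ?K" using that False E(1) by (auto simp: subspace_scale)
    then have "((1 / norm w) *\<^sub>R w) \<bullet> (S *v ((1 / norm w) *\<^sub>R w)) \<le> t" using max t_def by blast
    then show ?thesis using False
      by (simp add: matrix_vector_mult_scaleR field_simps power2_norm_eq_inner[symmetric] power2_eq_square)
  qed auto
  have "v \<bullet> v = 1" using v by (simp add: norm_eq_1)
  have "t * (v \<bullet> u) - u \<bullet> (S *v v) = 0" if "u \<in> E" for u
  proof -
    have "2 * (t * (v \<bullet> u) - u \<bullet> (S *v v)) = 0"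
    proof (rule quadratic_nonneg_imp_linear_zero)
      fix c :: real
      have "v + c *\<^sub>R u \<in> E" using v that E(1) by (auto simp: subspace_add subspace_scale)
      then have "(v + c *\<^sub>R u) \<bullet> (S *v (v + c *\<^sub>R u)) \<le> t * ((v + c *\<^sub>R u) \<bullet> (v + c *\<^sub>R u))"
        by (rule form)
      then show "0 \<le> 2 * (t * (v \<bullet> u) - u \<bullet> (S *v v)) * c + (t * (u \<bullet> u) - u \<bullet> (S *v u)) * c\<^sup>2"
        using \<open>v \<bullet> v = 1\<close> symmetric_matrix_inner[OF S, of v u]
        by (simp add: matrix_vector_mult_scaleR matrix_vector_right_distrib inner_add_left inner_add_right
          inner_commute[of u v] t_def[symmetric] power2_eq_square algebra_simps)
    qed
    then show ?thesis by simp
  qed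
  moreover have "t *\<^sub>R v - S *v v \<in> E" using v E(1) inv by (auto simp: subspace_diff subspace_scale)
  ultimately have "t * (v \<bullet> (t *\<^sub>R v - S *v v)) - (t *\<^sub>R v - S *v v) \<bullet> (S *v v) = 0" by blast
  then have "(t *\<^sub>R v - S *v v) \<bullet> (t *\<^sub>R v - S *v v) = 0"
    by (simp add: inner_diff_left inner_diff_right inner_commute algebra_simps)
  then have "S *v v = t *\<^sub>R v" by simp
  moreover have "v \<noteq> 0" "v \<in> E" using v by auto
  ultimately show ?thesis unfolding eigenvalues_on_def by blast
qed

text \<open>Eigenvectors for distinct eigenvalues are orthogonal, hence independent, and an
  independent set is finite here.\<close>

lemma symmetric_matrix_eigenvalues_finite:
  fixes S :: "real^'a^'a"
  assumes S: "transpose S = S"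
  shows "finite (eigenvalues_on E S)"
proof -
  let ?T = "eigenvalues_on E S"
  have "\<forall>t\<in>?T. \<exists>v. v \<noteq> 0 \<and> S *v v = t *\<^sub>R v" unfolding eigenvalues_on_def by blast
  then obtain v where v: "\<And>t. t \<in> ?T \<Longrightarrow> v t \<noteq> 0 \<and> S *v v t = t *\<^sub>R v t" by metis
  have orth: "v s \<bullet> v t = 0" if "s \<in> ?T" "t \<in> ?T" "s \<noteq> t" for s t
    using symmetric_matrix_inner[OF S, of "v s" "v t"] v that by (simp add: inner_commute)
  have "inj_on v ?T" using orth v by (intro inj_onI) (metis inner_eq_zero_iff)
  moreover have "independent (v ` ?T)"
    using orth v by (intro pairwise_orthogonal_independent) (auto simp: pairwise_def orthogonal_def)
  then have "finite (v ` ?T)" by (rule independent_imp_finite)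
  ultimately show ?thesis using finite_imageD by blast
qed

lemma lambda_max_on_in_eigenvalues_on:
  fixes S :: "real^'a^'a"
  assumes "transpose S = S" "subspace E" "E \<noteq> {0}" "\<And>v. v \<in> E \<Longrightarrow> S *v v \<in> E"
  shows "lambda_max_on E S \<in> eigenvalues_on E S"
  unfolding lambda_max_on_def
  by (intro Max_in symmetric_matrix_eigenvalue_exists symmetric_matrix_eigenvalues_finite assms)

lemma lambda_min_in_eigenvalues_on:
  fixes S :: "real^'a^'a"
  assumes "transpose S = S"
  shows "lambda_min S \<in> eigenvalues_on UNIV S"
proof -
  have "UNIV \<noteq> {0 :: real^'a}" using UNIV_not_singleton by blast
  then show ?thesis unfolding lambda_min_def
    by (intro Min_in symmetric_matrix_eigenvalue_exists symmetric_matrix_eigenvalues_finite assms) auto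
qed

definition sym_pos_def :: "real^'a^'a \<Rightarrow> bool" where
  "sym_pos_def S \<longleftrightarrow> transpose S = S \<and> (\<forall>v. v \<noteq> 0 \<longrightarrow> 0 < v \<bullet> (S *v v))"

lemma sym_pos_def_eigenvalue_pos:
  assumes "sym_pos_def S" "t \<in> eigenvalues_on E S"
  shows "0 < t"
proof -
  obtain v where "v \<noteq> 0" "S *v v = t *\<^sub>R v" using assms(2) unfolding eigenvalues_on_def by blast
  moreover from this have "0 < v \<bullet> (S *v v)" using assms(1) unfolding sym_pos_def_def by blast
  ultimately have "0 < t * (norm v)\<^sup>2" by (simp add: power2_norm_eq_inner)
  with \<open>v \<noteq> 0\<close> show ?thesis by (simp add: zero_less_mult_iff)
qed

lemma sym_pos_def_lambda_min_pos: "sym_pos_def S \<Longrightarrow> 0 < lambda_min S"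
  using sym_pos_def_eigenvalue_pos lambda_min_in_eigenvalues_on sym_pos_def_def by blast

lemma sym_pos_def_lambda_max_pos:
  fixes S :: "real^'a^'a"
  assumes "sym_pos_def S" shows "0 < lambda_max S"
proof -
  have "UNIV \<noteq> {0 :: real^'a}" using UNIV_not_singleton by blast
  then show ?thesis
    using assms sym_pos_def_eigenvalue_pos[OF assms lambda_max_on_in_eigenvalues_on]
    unfolding sym_pos_def_def by (metis UNIV_I subspace_UNIV)
qed

section \<open>The norm and distance of a positive definite matrix\<close>

lemma mat_norm_minus_commute: "mat_norm S (v - w) = mat_norm S (w - v)"
  unfolding mat_norm_def
  by (simp add: matrix_vector_mult_diff_distrib inner_diff_left inner_diff_right)

lemma continuous_on_mat_norm: "continuous_on T (mat_norm S)"
  unfolding mat_norm_def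
  by (intro continuous_on_real_sqrt continuous_on_inner continuous_on_id
      linear_continuous_on_compose[OF _ matrix_vector_mul_linear])

lemma tendsto_mat_norm [tendsto_intros]:
  assumes "(f \<longlongrightarrow> a) F"
  shows "((\<lambda>x. mat_norm S (f x)) \<longlongrightarrow> mat_norm S a) F"
proof -
  have "isCont (mat_norm S) a"
    using continuous_on_mat_norm[of UNIV S] continuous_on_eq_continuous_at by blast
  then show ?thesis using assms isCont_tendsto_compose by blast
qed

context
  fixes S :: "real^'a^'a"
  assumes spd: "sym_pos_def S"
begin

lemma mat_norm_form_nonneg: "0 \<le> v \<bullet> (S *v v)"
  using spd unfolding sym_pos_def_def by (cases "v = 0") (auto intro: less_imp_le)

lemma mat_norm_nonneg: "0 \<le> mat_norm S v"
  unfolding mat_norm_def using mat_norm_form_nonneg by simp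

lemma mat_norm_power2: "(mat_norm S v)\<^sup>2 = v \<bullet> (S *v v)"
  unfolding mat_norm_def using mat_norm_form_nonneg by simp

lemma mat_norm_Cauchy_Schwarz: "v \<bullet> (S *v w) \<le> mat_norm S v * mat_norm S w"
proof (cases "w = 0")
  case False
  define a b c where "a = v \<bullet> (S *v v)" and "b = v \<bullet> (S *v w)" and "c = w \<bullet> (S *v w)"
  have "c > 0" using False spd unfolding c_def sym_pos_def_def by blast
  \<comment> \<open>The coefficient \<open>b / c\<close> minimizes the form on the line through
    \<open>v\<close> in direction \<open>w\<close>.\<close>
  have "0 \<le> (v - (b / c) *\<^sub>R w) \<bullet> (S *v (v - (b / c) *\<^sub>R w))" by (rule mat_norm_form_nonneg)
  also have "\<dots> = a - 2 * (b / c) * b + (b / c)\<^sup>2 * c"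
    using symmetric_matrix_inner[of S w v] spd
    by (simp add: sym_pos_def_def a_def b_def c_def matrix_vector_mult_scaleR matrix_vector_mult_diff_distrib
        inner_diff_left inner_diff_right power2_eq_square algebra_simps)
  also have "\<dots> = a - b\<^sup>2 / c" using \<open>c > 0\<close> by (simp add: power2_eq_square field_simps)
  finally have "b\<^sup>2 \<le> a * c" using \<open>c > 0\<close> by (simp add: field_simps)
  then have "b \<le> sqrt (a * c)" by (rule real_le_rsqrt)
  then show ?thesis by (simp add: mat_norm_def a_def b_def c_def real_sqrt_mult)
qed (simp add: mat_norm_def)

lemma mat_norm_triangle: "mat_norm S (v + w) \<le> mat_norm S v + mat_norm S w"
proof (rule power2_le_imp_le)
  have "(mat_norm S (v + w))\<^sup>2 = v \<bullet> (S *v v) + 2 * (v \<bullet> (S *v w)) + w \<bullet> (S *v w)"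
    using symmetric_matrix_inner[of S w v] spd unfolding mat_norm_power2
    by (simp add: sym_pos_def_def matrix_vector_right_distrib inner_add_left inner_add_right)
  then show "(mat_norm S (v + w))\<^sup>2 \<le> (mat_norm S v + mat_norm S w)\<^sup>2"
    using mat_norm_Cauchy_Schwarz[of v w] by (simp add: power2_sum mat_norm_power2)
qed (simp add: mat_norm_nonneg)

lemma mat_norm_triangle_diff: "mat_norm S (a - c) \<le> mat_norm S (a - b) + mat_norm S (b - c)"
  using mat_norm_triangle[of "a - b" "b - c"] by simp

text \<open>The constant is the minimum over the compact Euclidean unit sphere, positive by
  definiteness; homogeneity extends the bound. It transfers convergence and the Cauchy property to
  the Euclidean norm.\<close>

lemma mat_norm_ge_norm: obtains c where "0 < c" "\<And>v. c * norm v \<le> mat_norm S v"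
proof -
  have "compact (sphere (0 :: real^'a) 1)" by simp
  moreover have "(axis undefined 1 :: real^'a) \<in> sphere 0 1" by simp
  moreover have "continuous_on (sphere (0 :: real^'a) 1) (mat_norm S)"
    by (rule continuous_on_mat_norm)
  ultimately obtain e where e: "e \<in> sphere 0 1" "\<forall>v\<in>sphere 0 1. mat_norm S e \<le> mat_norm S v"
    using continuous_attains_inf[of "sphere (0 :: real^'a) 1" "mat_norm S"] by blast
  show ?thesis
  proof (rule that)
    show "0 < mat_norm S e" using e(1) spd unfolding mat_norm_def sym_pos_def_def
      by (metis mem_sphere_0 norm_zero real_sqrt_gt_zero zero_neq_one)
    fix v :: "real^'a"
    show "mat_norm S e * norm v \<le> mat_norm S v"
    proof (cases "v = 0")
      case False
      then have "mat_norm S e \<le> mat_norm S ((1 / norm v) *\<^sub>R v)" using e(2) by simp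
      also have "\<dots> = mat_norm S v / norm v"
        unfolding mat_norm_def
        by (simp add: matrix_vector_mult_scaleR real_sqrt_divide flip: power2_eq_square power2_norm_eq_inner)
      finally show ?thesis using False by (simp add: field_simps)
    qed (simp add: mat_norm_def)
  qed
qed

lemma mat_norm_LIMSEQ_zero:
  assumes "(\<lambda>n. mat_norm S (x n - y n)) \<longlonglongrightarrow> 0"
  shows "(\<lambda>n. x n - y n) \<longlonglongrightarrow> 0"
proof -
  obtain c where c: "0 < c" "\<And>v. c * norm v \<le> mat_norm S v" using mat_norm_ge_norm by blast
  show ?thesis
  proof (rule Lim_null_comparison)
    show "(\<lambda>n. mat_norm S (x n - y n) / c) \<longlonglongrightarrow> 0"
      using c(1) tendsto_divide[OF assms tendsto_const, of c] by simp
    show "\<forall>\<^sub>F n in sequentially. norm (x n - y n) \<le> mat_norm S (x n - y n) / c"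
      using c by (simp add: pos_le_divide_eq mult.commute)
  qed
qed

lemma mat_dist_nonneg: "C \<noteq> {} \<Longrightarrow> 0 \<le> mat_dist S v C"
  unfolding mat_dist_def by (intro cINF_greatest mat_norm_nonneg)

text \<open>\<open>mat_dist\<close> is an infimum; near-minimizers avoid having to show that it is
  attained.\<close>

lemma mat_dist_approx:
  assumes "C \<noteq> {}" "e > 0"
  obtains v' where "v' \<in> C" "mat_norm S (v - v') < mat_dist S v C + e"
proof -
  have "mat_dist S v C < mat_dist S v C + e" using assms by simp
  then show ?thesis
    using that cINF_less_iff[of C "\<lambda>v'. mat_norm S (v - v')"] assms
    unfolding mat_dist_def by (metis bdd_belowI2 mat_norm_nonneg)
qed

text \<open>Points of \<open>C\<close> chosen within \<open>inverse (Suc k)\<close> of the distance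
  from \<open>x k\<close> approach \<open>x k\<close>, hence converge to \<open>l\<close> as
  well.\<close>

lemma mat_dist_LIMSEQ_closed:
  assumes "closed C" "C \<noteq> {}" "x \<longlonglongrightarrow> l" "(\<lambda>k. mat_dist S (x k) C) \<longlonglongrightarrow> 0"
  shows "l \<in> C"
proof -
  have "\<forall>k. \<exists>v'. v' \<in> C \<and> mat_norm S (x k - v') < mat_dist S (x k) C + inverse (Suc k)"
  proof
    fix k
    obtain v' where "v' \<in> C" "mat_norm S (x k - v') < mat_dist S (x k) C + inverse (Suc k)"
      by (rule mat_dist_approx[OF assms(2), of "inverse (Suc k)" "x k"]) simp
    then show "\<exists>v'. v' \<in> C \<and> mat_norm S (x k - v') < mat_dist S (x k) C + inverse (Suc k)" by blast
  qed
  then obtain y where y: "\<And>k. y k \<in> C" "\<And>k. mat_norm S (x k - y k) < mat_dist S (x k) C + inverse (Suc k)"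
    by metis
  have "(\<lambda>k. mat_norm S (x k - y k)) \<longlonglongrightarrow> 0"
  proof (rule tendsto_sandwich[OF _ _ tendsto_const])
    show "(\<lambda>k. mat_dist S (x k) C + inverse (real (Suc k))) \<longlonglongrightarrow> 0"
      using tendsto_add[OF assms(4) LIMSEQ_inverse_real_of_nat] by simp
  qed (use mat_norm_nonneg y(2) in \<open>auto intro!: always_eventually intro: less_imp_le\<close>)
  then have "(\<lambda>k. x k - y k) \<longlonglongrightarrow> 0" by (rule mat_norm_LIMSEQ_zero)
  then have "(\<lambda>k. x k - (x k - y k)) \<longlonglongrightarrow> l - 0" by (intro tendsto_intros assms)
  then show ?thesis using closed_sequentially[OF assms(1)] y(1) by auto
qed

lemma mat_dist_pos:
  assumes "closed C" "C \<noteq> {}" "v \<notin> C"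
  shows "0 < mat_dist S v C"
proof -
  have "mat_dist S v C \<noteq> 0"
    using mat_dist_LIMSEQ_closed[OF assms(1,2) tendsto_const, of v] assms(3) by auto
  then show ?thesis using mat_dist_nonneg[OF assms(2), of v] by simp
qed

text \<open>The algorithm enters only through \<open>fejer\<close>, which bounds single steps, and
  \<open>contr\<close>, which makes these bounds geometric. The factor 2 in the constant is that of
  the step bound, and \<open>1 - r\<close> comes from summing the series.\<close>

lemma fejer_monotone_linear_convergence:
  assumes C: "closed C" "C \<noteq> {}" and r: "0 \<le> r" "r < 1"
    and fejer: "\<And>k v. v \<in> C \<Longrightarrow> mat_norm S (w (Suc k) - v) \<le> mat_norm S (w k - v)"
    and contr: "\<And>k. mat_dist S (w (Suc k)) C \<le> r * mat_dist S (w k) C"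
  shows "\<exists>l\<in>C. \<forall>k. mat_norm S (w k - l) \<le> 2 * mat_dist S (w 0) C / (1 - r) * r ^ k"
proof -
  define D where "D = mat_dist S (w 0) C"
  have "0 \<le> D" unfolding D_def by (rule mat_dist_nonneg[OF C(2)])
  have dist: "mat_dist S (w k) C \<le> D * r ^ k" for k
  proof (induction k)
    case (Suc k)
    have "mat_dist S (w (Suc k)) C \<le> r * mat_dist S (w k) C" by (rule contr)
    also have "\<dots> \<le> r * (D * r ^ k)" using Suc r by (intro mult_left_mono)
    finally show ?case by (simp add: mult_ac)
  qed (simp add: D_def)
  have step: "mat_norm S (w k - w (Suc k)) \<le> 2 * D * r ^ k" for k
  proof -
    \<comment> \<open>Halved so that the claim becomes a lower bound for every member of the
      infimum; no nearest point is needed.\<close>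
    have "mat_norm S (w k - w (Suc k)) / 2 \<le> mat_dist S (w k) C"
      unfolding mat_dist_def
    proof (rule cINF_greatest[OF C(2)])
      fix v assume "v \<in> C"
      have "mat_norm S (w k - w (Suc k)) \<le> mat_norm S (w k - v) + mat_norm S (v - w (Suc k))"
        by (rule mat_norm_triangle_diff)
      also have "\<dots> \<le> 2 * mat_norm S (w k - v)"
        using fejer[OF \<open>v \<in> C\<close>, of k] by (simp add: mat_norm_minus_commute[of S v])
      finally show "mat_norm S (w k - w (Suc k)) / 2 \<le> mat_norm S (w k - v)" by simp
    qed
    then show ?thesis using dist[of k] by simp
  qed
  \<comment> \<open>The factor \<open>1 - r ^ m\<close> keeps the exact partial geometric sum; the
    bound without it would not survive the induction.\<close>
  have tail: "mat_norm S (w k - w (k + m)) \<le> 2 * D / (1 - r) * r ^ k * (1 - r ^ m)" for k m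
  proof (induction m)
    case (Suc m)
    have "mat_norm S (w k - w (k + Suc m)) \<le> mat_norm S (w k - w (k + m)) + mat_norm S (w (k + m) - w (Suc (k + m)))"
      using mat_norm_triangle_diff by simp
    also have "\<dots> \<le> 2 * D / (1 - r) * r ^ k * (1 - r ^ m) + 2 * D * r ^ (k + m)"
      using Suc step by (intro add_mono)
    also have "2 * D * r ^ (k + m) = 2 * D / (1 - r) * r ^ k * ((1 - r) * r ^ m)"
      using r by (simp add: power_add)
    also have "2 * D / (1 - r) * r ^ k * (1 - r ^ m) + \<dots> = 2 * D / (1 - r) * r ^ k * (1 - r ^ Suc m)"
      unfolding distrib_left[symmetric] by (simp add: algebra_simps)
    finally show ?case .
  qed (simp add: mat_norm_def)
  have bound: "mat_norm S (w k - w n) \<le> 2 * D / (1 - r) * r ^ k" if "k \<le> n" for k n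
  proof -
    have n: "n = k + (n - k)" using that by simp
    have "mat_norm S (w k - w n) \<le> 2 * D / (1 - r) * r ^ k * (1 - r ^ (n - k))" using tail[of k "n - k"] n by simp
    also have "\<dots> \<le> 2 * D / (1 - r) * r ^ k * 1" using r \<open>0 \<le> D\<close> by (intro mult_left_mono) auto
    finally show ?thesis by simp
  qed
  obtain c where c: "0 < c" "\<And>v. c * norm v \<le> mat_norm S v" using mat_norm_ge_norm by blast
  have pow: "(\<lambda>k. r ^ k) \<longlonglongrightarrow> 0" using r by (intro LIMSEQ_realpow_zero) auto
  have "Cauchy w"
  proof (rule CauchyI')
    fix e :: real assume "0 < e"
    have "(\<lambda>k. 2 * D / (1 - r) * r ^ k) \<longlonglongrightarrow> 2 * D / (1 - r) * 0" by (intro tendsto_intros pow)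
    then have "\<forall>\<^sub>F k in sequentially. 2 * D / (1 - r) * r ^ k < c * e"
      by (rule order_tendstoD(2)) (use \<open>0 < e\<close> c(1) in simp)
    then obtain M where M: "\<And>k. k \<ge> M \<Longrightarrow> 2 * D / (1 - r) * r ^ k < c * e"
      unfolding eventually_sequentially by blast
    have "norm (w m - w n) < e" if "m \<ge> M" "n > m" for m n
    proof -
      have "c * norm (w m - w n) < c * e"
        using c(2)[of "w m - w n"] bound[of m n] M[of m] that by linarith
      then show ?thesis using c(1) by simp
    qed
    then show "\<exists>M. \<forall>m\<ge>M. \<forall>n>m. dist (w m) (w n) < e" unfolding dist_norm by blast
  qed
  then obtain l where l: "w \<longlonglongrightarrow> l" using Cauchy_convergent_iff convergent_def by blast
  have "(\<lambda>k. mat_dist S (w k) C) \<longlonglongrightarrow> 0"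
  proof (rule tendsto_sandwich[OF _ _ tendsto_const])
    show "(\<lambda>k. D * r ^ k) \<longlonglongrightarrow> 0" using tendsto_mult_left[OF pow, of D] by simp
  qed (use dist mat_dist_nonneg[OF C(2)] in auto)
  then have "l \<in> C" using mat_dist_LIMSEQ_closed[OF C l] by blast
  moreover have "mat_norm S (w k - l) \<le> 2 * D / (1 - r) * r ^ k" for k
  proof (rule tendsto_upperbound)
    show "(\<lambda>n. mat_norm S (w k - w n)) \<longlonglongrightarrow> mat_norm S (w k - l)" by (intro tendsto_intros l)
    show "\<forall>\<^sub>F n in sequentially. mat_norm S (w k - w n) \<le> 2 * D / (1 - r) * r ^ k"
      using bound by (auto simp: eventually_sequentially)
  qed simp
  ultimately show ?thesis unfolding D_def by blast
qed

end

section \<open>Blocks and stacked vectors\<close>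

lemma linear_block: "linear (block bl i)"
  by (rule linearI) (auto simp: block_def vec_eq_iff)

lemma subspace_block_space: "subspace (block_space bl i)"
  by (auto simp: subspace_def block_space_def)

lemma block_in_block_space: "block bl i v \<in> block_space bl i"
  by (simp add: block_def block_space_def)

lemma block_of_block_space: "z \<in> block_space bl i \<Longrightarrow> block bl i z = z"
  by (auto simp: block_def block_space_def vec_eq_iff)

lemma sum_block: "(\<Sum>i\<in>UNIV. block bl (i::'b::finite) v) = v"
  by (simp add: block_def vec_eq_iff if_distrib cong: if_cong)

lemma replace_block_eq: "replace_block bl i z v = v + block bl i (z - v)"
  by (auto simp: replace_block_def block_def vec_eq_iff)

lemma block_replace_block:
  "block bl k (replace_block bl i z v) = (if k = i then block bl i z else block bl k v)"
  by (auto simp: replace_block_def block_def vec_eq_iff)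

lemma block_cols_mult_vec: "block_cols bl i A *v v = A *v block bl i v"
  by (auto simp: block_cols_def block_def matrix_vector_mult_def vec_eq_iff intro!: sum.cong)

lemma block_cols_mult_block: "block_cols bl i A *v block bl i v = block_cols bl i A *v v"
  by (simp add: block_cols_mult_vec block_of_block_space block_in_block_space)

lemma sum_block_cols_mult_vec: "(\<Sum>i\<in>UNIV. block_cols bl (i::'b::finite) A *v v) = A *v v"
proof -
  have "(\<Sum>i\<in>UNIV. A *v block bl i v) = A *v (\<Sum>i\<in>UNIV. block bl i v)"
    by (rule linear_sum[OF matrix_vector_mul_linear, symmetric])
  then show ?thesis by (simp add: block_cols_mult_vec sum_block)
qed

text \<open>Cauchy-Schwarz over the blocks costs a factor equal to their number, which is where the
  thresholds \<open>p - 1\<close> and \<open>q - 1\<close> for the proximal parameters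
  originate.\<close>

lemma norm_mult_vec_le_blocks:
  fixes A :: "real^'a^'n" and bl :: "'a \<Rightarrow> 'b::finite"
  shows "(norm (A *v v))\<^sup>2 \<le> real CARD('b) * (\<Sum>i\<in>UNIV. (norm (block_cols bl i A *v v))\<^sup>2)"
proof -
  have "norm (A *v v) \<le> (\<Sum>i\<in>UNIV. norm (block_cols bl i A *v v))"
    using norm_sum[of "\<lambda>i. block_cols bl i A *v v" UNIV] by (simp add: sum_block_cols_mult_vec)
  then have "(norm (A *v v))\<^sup>2 \<le> (\<Sum>i\<in>UNIV. norm (block_cols bl i A *v v))\<^sup>2"
    by (intro power_mono) auto
  also have "\<dots> \<le> (\<Sum>i\<in>UNIV. (norm (block_cols bl i A *v v))\<^sup>2) * real CARD('b)"
    by (rule sum_squared_le_sum_of_squares)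
  finally show ?thesis by (simp add: mult.commute)
qed

lemma block_space_eq_span: "block_space bl i = span ((\<lambda>a. axis a 1) ` {a. bl a = i})"
proof
  show "span ((\<lambda>a. axis a 1) ` {a. bl a = i}) \<subseteq> block_space bl i"
    by (rule span_minimal[OF _ subspace_block_space]) (auto simp: block_space_def axis_def)
  show "block_space bl i \<subseteq> span ((\<lambda>a. axis a 1) ` {a. bl a = i})"
  proof
    fix v assume v: "v \<in> block_space bl i"
    have "v = (\<Sum>a\<in>{a. bl a = i}. v $ a *\<^sub>R axis a 1)"
    proof (subst vec_eq_iff, intro allI)
      fix b
      have "(\<Sum>a\<in>{a. bl a = i}. v $ a *\<^sub>R axis a 1) $ b = (\<Sum>a\<in>{a. bl a = i}. if a = b then v $ a else 0)"
        by (intro trans[OF sum_component] sum.cong) (auto simp: axis_def)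
      then show "v $ b = (\<Sum>a\<in>{a. bl a = i}. v $ a *\<^sub>R axis a 1) $ b"
        using v by (simp add: block_space_def)
    qed
    also have "\<dots> \<in> span ((\<lambda>a. axis a 1) ` {a. bl a = i})"
      by (intro span_sum span_scale span_base) auto
    finally show "v \<in> span ((\<lambda>a. axis a 1) ` {a. bl a = i})" .
  qed
qed

text \<open>The image of the block space is spanned by the images of its coordinate vectors, and by
  the rank hypothesis its dimension is their number. A spanning set of that size is independent and
  its members are images of distinct vectors, so the map is injective on the span.\<close>

lemma full_rank_block_cols_injective:
  fixes A :: "real^'a^'n"
  assumes rank: "rank (block_cols bl i A) = card {a. bl a = i}"
    and v: "v \<in> block_space bl i" "block_cols bl i A *v v = 0"
  shows "v = 0"
proof -
  let ?L = "(*v) (block_cols bl i A)" and ?B = "(\<lambda>a. axis a 1 :: real^'a) ` {a. bl a = i}"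
  \<comment> \<open>Columns outside the block vanish, so restricting to the block space loses
    nothing of the range.\<close>
  have "range ?L = ?L ` block_space bl i"
    using block_cols_mult_block[of bl i A] block_in_block_space[of bl i] by (force intro: rev_image_eqI)
  also have "\<dots> = span (?L ` ?B)" unfolding block_space_eq_span
    by (rule linear_span_image[symmetric]) (rule matrix_vector_mul_linear)
  finally have "dim (span (?L ` ?B)) = card {a. bl a = i}"
    using rank rank_dim_range[of "block_cols bl i A"] by simp
  moreover have "card ?B = card {a. bl a = i}"
    by (intro card_image) (auto simp: inj_on_def axis_eq_axis)
  ultimately have card: "dim (span (?L ` ?B)) = card ?B" by simp
  have "card (?L ` ?B) \<le> card ?B" by (intro card_image_le) auto
  then have "independent (?L ` ?B)"
    using card by (intro card_le_dim_spanning[of _ "span (?L ` ?B)"] span_superset) auto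
  moreover from this have "card (?L ` ?B) = card ?B"
    using card by (metis dim_span dim_eq_card_independent)
  then have "inj_on ?L ?B" by (intro eq_card_imp_inj_on) auto
  ultimately have "inj_on ?L (span ?B)"
    using linear_inj_on_span_iff_independent_image[OF matrix_vector_mul_linear] by blast
  then have "inj_on ?L (block_space bl i)" by (simp add: block_space_eq_span)
  then show ?thesis
    using v subspace_0[OF subspace_block_space[of bl i]] unfolding inj_on_def
    by (metis matrix_vector_mult_0_right)
qed

lemma full_rank_blocks_zero:
  fixes A :: "real^'a^'n" and bl :: "'a \<Rightarrow> 'b::finite"
  assumes rank: "\<And>i. rank (block_cols bl i A) = card {a. bl a = i}"
    and zero: "\<And>i. block_cols bl i A *v v = 0"
  shows "v = 0"
proof -
  have "block bl i v = 0" for i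
    using full_rank_block_cols_injective[OF rank block_in_block_space] zero
    by (simp add: block_cols_mult_block)
  then show ?thesis using sum_block[of bl v] by simp
qed

lemma full_rank_blocks_sum_pos:
  fixes A :: "real^'a^'n" and bl :: "'a \<Rightarrow> 'b::finite"
  assumes rank: "\<And>i. rank (block_cols bl i A) = card {a. bl a = i}" and "v \<noteq> 0"
  shows "0 < (\<Sum>i\<in>UNIV. (norm (block_cols bl i A *v v))\<^sup>2)"
proof -
  obtain i where "block_cols bl i A *v v \<noteq> 0" using full_rank_blocks_zero[OF rank] \<open>v \<noteq> 0\<close> by blast
  then show ?thesis by (intro sum_pos2[of _ i]) auto
qed

text \<open>An eigenvalue \<open>t\<close> with eigenvector \<open>v\<close> satisfies
  \<open>t * (v \<bullet> v) = (?C *v v) \<bullet> (?C *v v)\<close>. Surjectivity of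
  \<open>bl\<close> makes the block space nontrivial, so that the maximum is an eigenvalue at
  all.\<close>

lemma lambda_max_on_gram_nonneg:
  fixes A :: "real^'a^'n"
  assumes "surj bl"
  shows "0 \<le> lambda_max_on (block_space bl i) (transpose (block_cols bl i A) ** block_cols bl i A)"
proof -
  let ?C = "block_cols bl i A"
  let ?S = "transpose ?C ** ?C"
  obtain a where "bl a = i" using assms by (metis surjD)
  then have "axis a 1 \<in> block_space bl i" by (auto simp: block_space_def axis_def)
  moreover have "(axis a 1 :: real^'a) \<noteq> 0" by (simp add: axis_eq_0_iff)
  ultimately have nz: "block_space bl i \<noteq> {0 :: real^'a}" by blast
  have "transpose ?S = ?S" by (simp add: matrix_transpose_mul)
  moreover have "transpose ?C *v y \<in> block_space bl i" for y
    by (simp add: block_space_def block_cols_def vector_matrix_mult_def)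
  then have "?S *v v \<in> block_space bl i" for v by (simp only: flip: matrix_vector_mul_assoc)
  ultimately have "lambda_max_on (block_space bl i) ?S \<in> eigenvalues_on (block_space bl i) ?S"
    using nz by (intro lambda_max_on_in_eigenvalues_on subspace_block_space)
  then obtain v where v: "v \<noteq> 0" "?S *v v = lambda_max_on (block_space bl i) ?S *\<^sub>R v"
    unfolding eigenvalues_on_def by blast
  then have "lambda_max_on (block_space bl i) ?S * (v \<bullet> v) = (?C *v v) \<bullet> (?C *v v)"
    using inner_gram[of v ?C ?C v] by simp
  then show ?thesis using v(1)
    by (metis inner_ge_zero inner_gt_zero_iff zero_le_mult_iff not_le)
qed

section \<open>Calculus of stacked vectors\<close>

lemma x_part_stack [simp]: "x_part (stack x y l) = x"
  and y_part_stack [simp]: "y_part (stack x y l) = y"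
  and l_part_stack [simp]: "l_part (stack x y l) = l"
  by (simp_all add: x_part_def y_part_def l_part_def stack_def vec_eq_iff)

lemma primal_dual_eq_iff: "v = w \<longleftrightarrow> x_part v = x_part w \<and> y_part v = y_part w \<and> l_part v = l_part w"
proof
  assume *: "x_part v = x_part w \<and> y_part v = y_part w \<and> l_part v = l_part w"
  show "v = w"
  proof (subst vec_eq_iff, rule allI)
    fix k :: "'a + 'b + 'c"
    consider a where "k = Inl a" | b where "k = Inr (Inl b)" | e where "k = Inr (Inr e)"
      by (metis sum.exhaust)
    then show "v $ k = w $ k" using * by cases (auto simp: x_part_def y_part_def l_part_def vec_eq_iff)
  qed
qed auto

lemma linear_x_part: "linear x_part"
  and linear_y_part: "linear y_part"
  and linear_l_part: "linear l_part"
  by (auto intro!: linearI simp: x_part_def y_part_def l_part_def vec_eq_iff)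

lemmas part_simps = linear_add[OF linear_x_part] linear_diff[OF linear_x_part]
  linear_add[OF linear_y_part] linear_diff[OF linear_y_part]
  linear_add[OF linear_l_part] linear_diff[OF linear_l_part]
  linear_0[OF linear_x_part] linear_0[OF linear_y_part] linear_0[OF linear_l_part]

lemma inner_primal_dual:
  "v \<bullet> w = x_part v \<bullet> x_part w + y_part v \<bullet> y_part w + l_part v \<bullet> l_part w"
proof -
  have "v \<bullet> w = (\<Sum>k\<in>UNIV <+> UNIV <+> UNIV. v $ k * w $ k)" by (simp add: inner_vec_def)
  also have "\<dots> = x_part v \<bullet> x_part w + y_part v \<bullet> y_part w + l_part v \<bullet> l_part w"
    by (simp add: sum.Plus inner_vec_def x_part_def y_part_def l_part_def del: UNIV_Plus_UNIV)
  finally show ?thesis .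
qed

lemma block_mat3_mult_vec:
  "block_mat3 S11 S12 S13 S21 S22 S23 S31 S32 S33 *v w =
     stack (S11 *v x_part w + S12 *v y_part w + S13 *v l_part w)
           (S21 *v x_part w + S22 *v y_part w + S23 *v l_part w)
           (S31 *v x_part w + S32 *v y_part w + S33 *v l_part w)"
proof -
  have row: "(A *v v) $ k = (A $ k) \<bullet> v" for A :: "real^'u^'v" and v k
    by (simp add: matrix_vector_mult_def inner_vec_def)
  show ?thesis
    unfolding primal_dual_eq_iff x_part_stack y_part_stack l_part_stack
    by (simp add: x_part_def y_part_def l_part_def vec_eq_iff row)
      (simp add: block_mat3_def inner_primal_dual stack_def x_part_def y_part_def l_part_def)
qed

text \<open>All blocks are updated from the same old point \<open>x\<close>, so each proximal
  inequality contains the same residual \<open>\<rho> x\<close> and they can be summed, the blocks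
  of \<open>C\<close> recombining to \<open>C\<close>. The abstract \<open>\<phi>\<close> and
  \<open>\<rho>\<close> serve both groups of variables.\<close>

lemma block_update_variational_inequality:
  fixes C :: "real^'a^'n" and bl :: "'a \<Rightarrow> 'b::finite"
  assumes f: "\<And>i. convex_on (block_space bl i) (f i)"
    and S: "\<And>i. convex (S i)" "\<And>i. S i \<subseteq> block_space bl i"
    and \<phi>: "\<And>z. \<phi> z = (\<Sum>i\<in>UNIV. f i (block bl i z)) + g"
    and \<rho>: "\<And>z. \<rho> z = C *v z + d"
    and step: "\<And>i. is_arg_min
      (\<lambda>z. \<phi> (replace_block bl i z x) - l \<bullet> \<rho> (replace_block bl i z x)
         + \<beta> / 2 * (norm (\<rho> (replace_block bl i z x)))\<^sup>2
         + \<sigma> * \<beta> / 2 * (norm (block_cols bl i C *v (z - block bl i x)))\<^sup>2)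
      (\<lambda>z. z \<in> S i) (block bl i x')"
    and v: "\<And>i. block bl i v \<in> S i"
  shows "0 \<le> (\<Sum>i\<in>UNIV. f i (block bl i v)) - (\<Sum>i\<in>UNIV. f i (block bl i x'))
    - (C *v (v - x')) \<bullet> (l - \<beta> *\<^sub>R \<rho> x)
    + (\<sigma> + 1) * \<beta> * (\<Sum>i\<in>UNIV. (block_cols bl i C *v (v - x')) \<bullet> (block_cols bl i C *v (x' - x)))"
proof -
  let ?b = "block bl" and ?C = "\<lambda>i. block_cols bl i C" and ?r = "replace_block bl"
  have block_ineq: "0 \<le> f i (?b i v) - f i (?b i x') + (?C i *v (v - x')) \<bullet> (\<beta> *\<^sub>R \<rho> x - l)
      + (\<sigma> + 1) * \<beta> * ((?C i *v (v - x')) \<bullet> (?C i *v (x' - x)))" for i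
  proof -
    have b: "?b i z = z" if "z \<in> S i" for z
      by (rule block_of_block_space[OF subsetD[OF S(2) that]])
    \<comment> \<open>With the other blocks frozen, the objective is \<open>f i\<close> plus a
      constant, which cancels in comparisons.\<close>
    have \<phi>_r: "\<phi> (?r i z x) = f i z + ((\<Sum>k\<in>UNIV - {i}. f k (?b k x)) + g)" if "z \<in> S i" for z
      unfolding \<phi> by (subst sum.remove[of _ i])
        (auto simp: block_replace_block b[OF that] intro!: sum.cong)
    have \<rho>_r: "\<rho> (?r i z x) = \<rho> x + ?C i *v (z - ?b i x)" if "z \<in> S i" for z
      unfolding \<rho> replace_block_eq block_cols_mult_vec matrix_vector_right_distrib
      by (simp add: linear_diff[OF linear_block] b[OF that] block_of_block_space block_in_block_space)
    have x': "?b i x' \<in> S i" using step[of i] by (simp add: is_arg_min_linorder)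
    have "0 \<le> f i (?b i v) - f i (?b i x') + (?C i *v (?b i v - ?b i x')) \<bullet> (\<beta> *\<^sub>R \<rho> x - l)
      + (\<sigma> + 1) * \<beta> * ((?C i *v (?b i v - ?b i x')) \<bullet> (?C i *v (?b i x' - ?b i x)))"
    proof (rule proximal_minimizer_variational_inequality[where S = "S i"])
      show "convex_on (S i) (f i)" by (rule convex_on_subset[OF f S(2,1)])
      fix z assume z: "z \<in> S i"
      then show "f i (?b i x') - l \<bullet> (\<rho> x + ?C i *v (?b i x' - ?b i x))
          + \<beta> / 2 * (norm (\<rho> x + ?C i *v (?b i x' - ?b i x)))\<^sup>2
          + \<sigma> * \<beta> / 2 * (norm (?C i *v (?b i x' - ?b i x)))\<^sup>2
        \<le> f i z - l \<bullet> (\<rho> x + ?C i *v (z - ?b i x))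
          + \<beta> / 2 * (norm (\<rho> x + ?C i *v (z - ?b i x)))\<^sup>2
          + \<sigma> * \<beta> / 2 * (norm (?C i *v (z - ?b i x)))\<^sup>2"
        using step[of i] x' by (auto simp: is_arg_min_linorder \<phi>_r \<rho>_r)
    qed (auto simp: x' v matrix_vector_mul_linear)
    then show ?thesis
      by (simp add: block_cols_mult_block flip: linear_diff[OF linear_block])
  qed
  have "0 \<le> (\<Sum>i\<in>UNIV. f i (?b i v) - f i (?b i x') + (?C i *v (v - x')) \<bullet> (\<beta> *\<^sub>R \<rho> x - l)
      + (\<sigma> + 1) * \<beta> * ((?C i *v (v - x')) \<bullet> (?C i *v (x' - x))))"
    by (intro sum_nonneg block_ineq)
  also have "\<dots> = (\<Sum>i\<in>UNIV. f i (?b i v)) - (\<Sum>i\<in>UNIV. f i (?b i x'))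
      + (C *v (v - x')) \<bullet> (\<beta> *\<^sub>R \<rho> x - l)
      + (\<sigma> + 1) * \<beta> * (\<Sum>i\<in>UNIV. (?C i *v (v - x')) \<bullet> (?C i *v (x' - x)))"
    by (simp only: sum.distrib sum_subtractf sum_distrib_left[symmetric] inner_sum_left[symmetric]
        sum_block_cols_mult_vec)
  finally show ?thesis by (simp add: inner_diff_right)
qed

section \<open>GS-ADMM\<close>

locale gs_admm_data =
  fixes P :: "('m::finite, 'd::finite, 'n::finite, 'p::finite, 'q::finite) problem"
    and \<beta> \<sigma>\<^sub>1 \<sigma>\<^sub>2 \<tau> s :: real
  assumes standing: "standing_assumptions P"
    and beta_pos: "\<beta> > 0"
    and sigma1: "\<sigma>\<^sub>1 > real CARD('p) - 1"
    and sigma2: "\<sigma>\<^sub>2 > real CARD('q) - 1"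
    and stepsizes: "(\<tau>, s) \<in> stepsize_region"
begin

abbreviation "A \<equiv> Amat P"
abbreviation "B \<equiv> Bmat P"
abbreviation "Q \<equiv> Q_mat P \<beta> \<sigma>\<^sub>1 \<sigma>\<^sub>2 \<tau>"
abbreviation "M \<equiv> M_mat P \<beta> \<tau> s"
abbreviation "H \<equiv> H_mat P \<beta> \<sigma>\<^sub>1 \<sigma>\<^sub>2 \<tau> s"
abbreviation "G \<equiv> G_mat P \<beta> \<sigma>\<^sub>1 \<sigma>\<^sub>2 \<tau> s"

lemma stepsize: "\<tau> < 1" "s < 1" "0 < \<tau> + s"
  using stepsizes by (auto simp: stepsize_region_def)

lemma sum_A_blk: "(\<Sum>i\<in>UNIV. A_blk P i *v v) = A *v v"
  by (simp add: A_blk_def sum_block_cols_mult_vec)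

lemma A_blk_sum_pos: "v \<noteq> 0 \<Longrightarrow> 0 < (\<Sum>i\<in>UNIV. (norm (A_blk P i *v v))\<^sup>2)"
  using standing full_rank_blocks_sum_pos[of "xblk P" A v]
  by (auto simp: standing_assumptions_def A_blk_def)

lemma B_blk_sum_pos: "v \<noteq> 0 \<Longrightarrow> 0 < (\<Sum>j\<in>UNIV. (norm (B_blk P j *v v))\<^sup>2)"
  using standing full_rank_blocks_sum_pos[of "yblk P" B v]
  by (auto simp: standing_assumptions_def B_blk_def)

section \<open>Quadratic forms and positive definiteness of \<open>H\<close> and
  \<open>G\<close>\<close>

text \<open>Extending the off-diagonal pattern to the diagonal yields all of
  \<open>- \<beta>\<close> times the Gram matrix of \<open>A\<close>; the correction raises the
  diagonal coefficient from \<open>\<sigma>\<^sub>1\<close> to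
  \<open>\<sigma>\<^sub>1 + 1\<close>.\<close>

lemma Hx_form:
  "v \<bullet> (Hx_mat P \<beta> \<sigma>\<^sub>1 *v w) =
     (\<sigma>\<^sub>1 + 1) * \<beta> * (\<Sum>i\<in>UNIV. (A_blk P i *v v) \<bullet> (A_blk P i *v w)) - \<beta> * ((A *v v) \<bullet> (A *v w))"
proof -
  define c where "c i l = (A_blk P i *v v) \<bullet> (A_blk P l *v w)" for i l
  have "v \<bullet> ((if i = l then (\<sigma>\<^sub>1 * \<beta>) *\<^sub>R (transpose (A_blk P i) ** A_blk P i)
        else (- \<beta>) *\<^sub>R (transpose (A_blk P i) ** A_blk P l)) *v w)
      = (if i = l then \<sigma>\<^sub>1 * \<beta> * c i l else - \<beta> * c i l)" for i l
    by (cases "i = l") (simp_all add: inner_gram c_def uminus_mult_vec flip: scaleR_matrix_vector_assoc)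
  then have "v \<bullet> (Hx_mat P \<beta> \<sigma>\<^sub>1 *v w) =
      (\<Sum>i\<in>UNIV. \<Sum>l\<in>UNIV. if i = l then \<sigma>\<^sub>1 * \<beta> * c i l else - \<beta> * c i l)"
    by (simp only: Hx_mat_def sum_mult_vec inner_sum_right)
  also have "\<dots> = (\<Sum>i\<in>UNIV. \<Sum>l\<in>UNIV. (if i = l then (\<sigma>\<^sub>1 + 1) * \<beta> * c i l else 0) - \<beta> * c i l)"
    by (intro sum.cong refl) (simp add: algebra_simps)
  also have "\<dots> = (\<sigma>\<^sub>1 + 1) * \<beta> * (\<Sum>i\<in>UNIV. c i i) - \<beta> * (\<Sum>i\<in>UNIV. \<Sum>l\<in>UNIV. c i l)"
    by (simp add: sum_subtractf sum_distrib_left)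
  also have "(\<Sum>i\<in>UNIV. \<Sum>l\<in>UNIV. c i l) = (A *v v) \<bullet> (A *v w)"
    unfolding c_def by (simp only: sum_A_blk flip: inner_sum_right inner_sum_left)
  finally show ?thesis unfolding c_def .
qed

text \<open>The full Gram form is at most \<open>p\<close> times the sum of the block forms, and
  \<open>p < \<sigma>\<^sub>1 + 1\<close>; full column rank makes that sum positive.\<close>

lemma Hx_form_pos:
  assumes "v \<noteq> 0" shows "0 < v \<bullet> (Hx_mat P \<beta> \<sigma>\<^sub>1 *v v)"
proof -
  define S where "S = (\<Sum>i\<in>UNIV. (norm (A_blk P i *v v))\<^sup>2)"
  have "0 < S" unfolding S_def using assms by (rule A_blk_sum_pos)
  have "(norm (A *v v))\<^sup>2 \<le> real CARD('p) * S"
    unfolding S_def A_blk_def by (rule norm_mult_vec_le_blocks)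
  also have "\<dots> < (\<sigma>\<^sub>1 + 1) * S" using sigma1 \<open>0 < S\<close> by (intro mult_strict_right_mono) auto
  finally have "0 < \<beta> * ((\<sigma>\<^sub>1 + 1) * S - (norm (A *v v))\<^sup>2)" using beta_pos by simp
  then show ?thesis
    unfolding Hx_form S_def by (simp add: power2_norm_eq_inner algebra_simps)
qed

lemma Hx_form_nonneg: "0 \<le> v \<bullet> (Hx_mat P \<beta> \<sigma>\<^sub>1 *v v)"
  using Hx_form_pos by (cases "v = 0") (auto intro: less_imp_le)

definition D_form :: "real^'d \<Rightarrow> real^'d \<Rightarrow> real" where
  "D_form v w = (\<Sum>j\<in>UNIV. (B_blk P j *v v) \<bullet> (B_blk P j *v w))"

lemma D_B_form: "v \<bullet> (D_B P *v w) = D_form v w"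
  unfolding D_B_def D_form_def sum_mult_vec inner_sum_right by (simp only: inner_gram)

lemma D_form_gt:
  assumes "v \<noteq> 0" shows "(norm (B *v v))\<^sup>2 < (\<sigma>\<^sub>2 + 1) * D_form v v"
proof -
  have "0 < D_form v v"
    unfolding D_form_def using B_blk_sum_pos[OF assms] by (simp add: power2_norm_eq_inner)
  have "(norm (B *v v))\<^sup>2 \<le> real CARD('q) * D_form v v"
    using norm_mult_vec_le_blocks[of B v "yblk P"]
    by (simp add: D_form_def B_blk_def power2_norm_eq_inner)
  also have "\<dots> < (\<sigma>\<^sub>2 + 1) * D_form v v"
    using sigma2 \<open>0 < D_form v v\<close> by (intro mult_strict_right_mono) auto
  finally show ?thesis .
qed

lemma D_form_ge: "(norm (B *v v))\<^sup>2 \<le> (\<sigma>\<^sub>2 + 1) * D_form v v"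
  using D_form_gt[of v] by (cases "v = 0") (auto simp: D_form_def)

lemma Q_form:
  "v \<bullet> (Q *v w) = x_part v \<bullet> (Hx_mat P \<beta> \<sigma>\<^sub>1 *v x_part w)
     + (\<sigma>\<^sub>2 + 1) * \<beta> * D_form (y_part v) (y_part w) - \<tau> * ((B *v y_part v) \<bullet> l_part w)
     - l_part v \<bullet> (B *v y_part w) + (l_part v \<bullet> l_part w) / \<beta>"
proof -
  have "y_part v \<bullet> (transpose B *v l_part w) = (B *v y_part v) \<bullet> l_part w"
    by (rule inner_transpose_mult_vec)
  then show ?thesis
    unfolding Q_mat_def inner_primal_dual block_mat3_mult_vec x_part_stack y_part_stack l_part_stack
    by (simp add: D_B_form inner_add_right inner_diff_right uminus_mult_vec del: transpose_matrix_vector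
        flip: scaleR_matrix_vector_assoc)
qed

lemma M_mult_vec:
  "M *v w = stack (x_part w) (y_part w) ((\<tau> + s) *\<^sub>R l_part w - (s * \<beta>) *\<^sub>R (B *v y_part w))"
  unfolding M_mat_def block_mat3_mult_vec primal_dual_eq_iff
  by (simp add: uminus_mult_vec flip: scaleR_matrix_vector_assoc)

lemma M_invertible: "invertible M"
  unfolding invertible_left_inverse matrix_left_invertible_ker
proof (intro allI impI)
  fix w assume *: "M *v w = 0"
  then have "x_part (M *v w) = 0" "y_part (M *v w) = 0" "l_part (M *v w) = 0"
    by (simp_all add: part_simps)
  then have "x_part w = 0" "y_part w = 0" "l_part w = 0"
    using stepsize by (simp_all add: M_mult_vec)
  then show "w = 0" by (simp add: primal_dual_eq_iff part_simps)
qed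

text \<open>The inverse of \<open>M\<close> is never computed: \<open>H\<close> is evaluated
  explicitly only at vectors \<open>M *v w\<close>.\<close>

lemma H_M_mult_vec: "H *v (M *v w) = Q *v w"
  using matrix_inv_inverse(2)[OF M_invertible]
  by (simp add: H_mat_def matrix_vector_mul_assoc flip: matrix_mul_assoc)

lemma M_surjective: obtains v where "w = M *v v"
  using matrix_inv_inverse(1)[OF M_invertible] by (metis matrix_vector_mul_assoc matrix_vector_mul_lid)

text \<open>The last row of \<open>M\<close> repairs the asymmetry of \<open>Q\<close>: the coupling
  \<open>- \<tau>\<close> gains \<open>- s\<close> and the coupling \<open>- 1\<close> is scaled by
  \<open>\<tau> + s\<close>, so both become \<open>- (\<tau> + s)\<close>.\<close>

lemma M_Q_form:
  "(M *v v) \<bullet> (Q *v w) = x_part v \<bullet> (Hx_mat P \<beta> \<sigma>\<^sub>1 *v x_part w)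
     + (\<sigma>\<^sub>2 + 1) * \<beta> * D_form (y_part v) (y_part w) + s * \<beta> * ((B *v y_part v) \<bullet> (B *v y_part w))
     - (\<tau> + s) * ((B *v y_part v) \<bullet> l_part w + l_part v \<bullet> (B *v y_part w))
     + (\<tau> + s) / \<beta> * (l_part v \<bullet> l_part w)"
  unfolding Q_form M_mult_vec x_part_stack y_part_stack l_part_stack
  using beta_pos by (simp add: inner_diff_left scaleR_left_distrib inner_add_left field_simps)

lemma M_Q_form_commute: "(M *v v) \<bullet> (Q *v w) = (M *v w) \<bullet> (Q *v v)"
  unfolding M_Q_form Hx_form D_form_def by (simp add: inner_commute)

lemma H_pos_def: "sym_pos_def H"
  unfolding sym_pos_def_def
proof (intro conjI allI impI)
  show "transpose H = H"
  proof (rule symmetric_matrixI)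
    fix v w
    obtain v' w' where "v = M *v v'" "w = M *v w'" using M_surjective by metis
    then show "v \<bullet> (H *v w) = w \<bullet> (H *v v)" by (simp add: H_M_mult_vec M_Q_form_commute)
  qed
next
  fix v :: "real^('m + 'd + 'n)" assume "v \<noteq> 0"
  obtain w where w: "v = M *v w" using M_surjective by metis
  define x y l where "x = x_part w" and "y = y_part w" and "l = l_part w"
  have "w \<noteq> 0" using w \<open>v \<noteq> 0\<close> by auto
  \<comment> \<open>Completing the square in \<open>l\<close> leaves
    \<open>- \<tau> * \<beta>\<close> times the squared norm of \<open>B *v y\<close>. Splitting
    this coefficient into \<open>- \<beta>\<close> and \<open>(1 - \<tau>) * \<beta>\<close> makes
    each summand nonnegative by one of the parameter conditions.\<close>
  have eq: "v \<bullet> (H *v v) = x \<bullet> (Hx_mat P \<beta> \<sigma>\<^sub>1 *v x)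
      + \<beta> * ((\<sigma>\<^sub>2 + 1) * D_form y y - (norm (B *v y))\<^sup>2) + (1 - \<tau>) * \<beta> * (norm (B *v y))\<^sup>2
      + (\<tau> + s) / \<beta> * (norm (l - \<beta> *\<^sub>R (B *v y)))\<^sup>2"
    unfolding w H_M_mult_vec M_Q_form x_def[symmetric] y_def[symmetric] l_def[symmetric] power2_norm_eq_inner
    using beta_pos by (simp add: inner_diff_left inner_diff_right inner_commute field_simps)
  have n1: "0 \<le> x \<bullet> (Hx_mat P \<beta> \<sigma>\<^sub>1 *v x)" by (rule Hx_form_nonneg)
  have n2: "0 \<le> \<beta> * ((\<sigma>\<^sub>2 + 1) * D_form y y - (norm (B *v y))\<^sup>2)"
    using D_form_ge beta_pos by simp
  have n3: "0 \<le> (1 - \<tau>) * \<beta> * (norm (B *v y))\<^sup>2" using stepsize beta_pos by simp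
  have n4: "0 \<le> (\<tau> + s) / \<beta> * (norm (l - \<beta> *\<^sub>R (B *v y)))\<^sup>2" using stepsize beta_pos by simp
  from \<open>w \<noteq> 0\<close> consider "x \<noteq> 0" | "y \<noteq> 0" | "x = 0" "y = 0" "l \<noteq> 0"
    unfolding x_def y_def l_def by (auto simp: primal_dual_eq_iff part_simps)
  then show "0 < v \<bullet> (H *v v)"
  proof cases
    case 1
    then show ?thesis using eq n1 n2 n3 n4 Hx_form_pos[of x] by linarith
  next
    case 2
    then have "0 < \<beta> * ((\<sigma>\<^sub>2 + 1) * D_form y y - (norm (B *v y))\<^sup>2)"
      using D_form_gt beta_pos by simp
    then show ?thesis using eq n1 n2 n3 n4 by linarith
  next
    case 3
    then have "0 < (\<tau> + s) / \<beta> * (norm (l - \<beta> *\<^sub>R (B *v y)))\<^sup>2" using stepsize beta_pos by simp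
    then show ?thesis using eq n1 n2 n3 n4 by linarith
  qed
qed

lemma G_form: "v \<bullet> (G *v w) = v \<bullet> (Q *v w) + w \<bullet> (Q *v v) - (M *v v) \<bullet> (Q *v w)"
proof -
  have "v \<bullet> (transpose Q *v w) = w \<bullet> (Q *v v)"
    unfolding inner_transpose_mult_vec by (rule inner_commute)
  moreover have "v \<bullet> ((transpose M ** Q) *v w) = (M *v v) \<bullet> (Q *v w)" by (rule inner_gram)
  ultimately show ?thesis
    by (simp add: G_mat_def matrix_vector_mult_add_rdistrib matrix_vector_mult_diff_rdistrib
        inner_add_right inner_diff_right del: transpose_matrix_vector)
qed

lemma G_pos_def: "sym_pos_def G"
  unfolding sym_pos_def_def
proof (intro conjI allI impI)
  show "transpose G = G"
    by (rule symmetric_matrixI) (simp add: G_form M_Q_form_commute)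
next
  fix v :: "real^('m + 'd + 'n)" assume "v \<noteq> 0"
  define x y l where "x = x_part v" and "y = y_part v" and "l = l_part v"
  \<comment> \<open>The cross term between \<open>l\<close> and \<open>B *v y\<close> has
    coefficient \<open>- 2 * (1 - s)\<close>, which fixes the weight of the square. What remains of
    the \<open>l\<close> term has weight \<open>(1 - \<tau>) / \<beta>\<close>, so
    \<open>s < 1\<close> and \<open>\<tau> < 1\<close> both enter.\<close>
  have eq: "v \<bullet> (G *v v) = x \<bullet> (Hx_mat P \<beta> \<sigma>\<^sub>1 *v x)
      + \<beta> * ((\<sigma>\<^sub>2 + 1) * D_form y y - (norm (B *v y))\<^sup>2) + (1 - \<tau>) / \<beta> * (norm l)\<^sup>2
      + (1 - s) / \<beta> * (norm (l - \<beta> *\<^sub>R (B *v y)))\<^sup>2"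
    unfolding G_form M_Q_form unfolding Q_form x_def[symmetric] y_def[symmetric] l_def[symmetric] power2_norm_eq_inner
    using beta_pos by (simp add: inner_diff_left inner_diff_right inner_commute field_simps)
  have n1: "0 \<le> x \<bullet> (Hx_mat P \<beta> \<sigma>\<^sub>1 *v x)" by (rule Hx_form_nonneg)
  have n2: "0 \<le> \<beta> * ((\<sigma>\<^sub>2 + 1) * D_form y y - (norm (B *v y))\<^sup>2)"
    using D_form_ge beta_pos by simp
  have n3: "0 \<le> (1 - \<tau>) / \<beta> * (norm l)\<^sup>2" using stepsize beta_pos by simp
  have n4: "0 \<le> (1 - s) / \<beta> * (norm (l - \<beta> *\<^sub>R (B *v y)))\<^sup>2" using stepsize beta_pos by simp
  consider "x \<noteq> 0" | "y \<noteq> 0" | "l \<noteq> 0"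
    using \<open>v \<noteq> 0\<close> unfolding x_def y_def l_def by (auto simp: primal_dual_eq_iff part_simps)
  then show "0 < v \<bullet> (G *v v)"
  proof cases
    case 1
    then show ?thesis using eq n1 n2 n3 n4 Hx_form_pos[of x] by linarith
  next
    case 2
    then have "0 < \<beta> * ((\<sigma>\<^sub>2 + 1) * D_form y y - (norm (B *v y))\<^sup>2)"
      using D_form_gt beta_pos by simp
    then show ?thesis using eq n1 n2 n3 n4 by linarith
  next
    case 3
    then have "0 < (1 - \<tau>) / \<beta> * (norm l)\<^sup>2" using stepsize beta_pos by simp
    then show ?thesis using eq n1 n2 n3 n4 by linarith
  qed
qed

section \<open>The solution set of the variational inequality\<close>

lemma f_convex: "convex_on (block_space (xblk P) i) (fobj P i)"
  and g_convex: "convex_on (block_space (yblk P) j) (gobj P j)"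
  and Xset_polyhedron: "polyhedron (Xset P i)"
  and Yset_polyhedron: "polyhedron (Yset P j)"
  and Xset_subset: "Xset P i \<subseteq> block_space (xblk P) i"
  and Yset_subset: "Yset P j \<subseteq> block_space (yblk P) j"
  using standing by (auto simp: standing_assumptions_def closed_proper_convex_on_def)

lemma M_set_polyhedron: "polyhedron (M_set P)"
proof -
  have "linear (\<lambda>w. block (xblk P) i (x_part w))" for i
    by (rule linear_compose[OF linear_x_part linear_block, unfolded o_def])
  moreover have "linear (\<lambda>w. block (yblk P) j (y_part w))" for j
    by (rule linear_compose[OF linear_y_part linear_block, unfolded o_def])
  moreover have "M_set P = (\<Inter>i\<in>UNIV. (\<lambda>w. block (xblk P) i (x_part w)) -` Xset P i)
      \<inter> (\<Inter>j\<in>UNIV. (\<lambda>w. block (yblk P) j (y_part w)) -` Yset P j)"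
    by (auto simp: M_set_def X_prod_def Y_prod_def)
  ultimately show ?thesis
    by (auto intro!: polyhedron_Int polyhedron_Inter polyhedron_linear_vimage
        simp: Xset_polyhedron Yset_polyhedron)
qed

lemma h_obj_convex: "convex_on UNIV (h_obj P)"
proof -
  have "convex_on UNIV (\<lambda>w. fobj P i (block (xblk P) i (x_part w)))" for i
    by (rule convex_on_linear_vimage[OF f_convex linear_compose[OF linear_x_part linear_block, unfolded o_def]
          block_in_block_space])
  moreover have "convex_on UNIV (\<lambda>w. gobj P j (block (yblk P) j (y_part w)))" for j
    by (rule convex_on_linear_vimage[OF g_convex linear_compose[OF linear_y_part linear_block, unfolded o_def]
          block_in_block_space])
  ultimately show ?thesis
    unfolding h_obj_def objective_def by (intro convex_on_add convex_on_sum_functions) auto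
qed

text \<open>The constraint operator lives on the whole primal-dual space and ignores the multiplier,
  so that the multiplier theorem applies directly with \<open>M_set\<close> as polyhedron.\<close>

definition K_map :: "real^('m + 'd + 'n) \<Rightarrow> real^'n" where
  "K_map w = A *v x_part w + B *v y_part w"

lemma linear_K_map: "linear K_map"
  unfolding K_map_def
  by (intro linear_compose_add linear_compose[OF linear_x_part, unfolded o_def]
      linear_compose[OF linear_y_part, unfolded o_def] matrix_vector_mul_linear)

lemma residual_K_map: "residual P (x_part w) (y_part w) = K_map w - rhs P"
  by (simp add: residual_def K_map_def)

lemma inner_J_map: "v \<bullet> J_map P w = l_part v \<bullet> (K_map w - rhs P) - K_map v \<bullet> l_part w"
proof -
  have "x_part v \<bullet> (transpose A *v l_part w) = (A *v x_part v) \<bullet> l_part w"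
    "y_part v \<bullet> (transpose B *v l_part w) = (B *v y_part v) \<bullet> l_part w"
    by (rule inner_transpose_mult_vec)+
  then show ?thesis
    by (simp add: J_map_def inner_primal_dual residual_K_map K_map_def inner_add_left
        del: transpose_matrix_vector)
qed

lemma M_star_closed: "closed (M_star P)"
proof -
  \<comment> \<open>A convex function that is finite on the whole finite-dimensional space is
    continuous.\<close>
  have cont: "continuous_on UNIV (h_obj P)"
    using h_obj_convex by (intro convex_on_continuous) auto
  have "closed {w'. 0 \<le> h_obj P w - h_obj P w' + (w - w') \<bullet> J_map P w}" for w
    by (intro closed_Collect_le continuous_intros cont)
  then have "closed (M_set P \<inter> {w'. 0 \<le> h_obj P w - h_obj P w' + (w - w') \<bullet> J_map P w})" for w
    by (rule closed_Int[OF polyhedron_imp_closed[OF M_set_polyhedron]])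
  moreover have "M_star P = (\<Inter>w\<in>M_set P. M_set P \<inter> {w'. 0 \<le> h_obj P w - h_obj P w' + (w - w') \<bullet> J_map P w})"
    by (auto simp: M_star_def)
  ultimately show ?thesis by (metis (no_types, lifting) closed_INT)
qed

lemma M_star_nonempty: "M_star P \<noteq> {}"
proof -
  obtain x y where "is_solution P x y" using standing by (auto simp: standing_assumptions_def)
  then have feas: "residual P x y = 0" "x \<in> X_prod P" "y \<in> Y_prod P"
    and opt: "\<And>x' y'. residual P x' y' = 0 \<Longrightarrow> x' \<in> X_prod P \<Longrightarrow> y' \<in> Y_prod P \<Longrightarrow>
      objective P x y \<le> objective P x' y'"
    by (force simp: is_solution_def is_arg_min_linorder)+
  \<comment> \<open>The multiplier 0 is a placeholder: neither \<open>h_obj\<close> nor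
    \<open>K_map\<close> depends on it.\<close>
  define u where "u = stack x y (0 :: real^'n)"
  have "u \<in> M_set P" using feas by (simp add: u_def M_set_def)
  have Ku: "K_map u = rhs P" using feas(1) by (simp add: u_def residual_def K_map_def)
  have "h_obj P u \<le> h_obj P v" if "v \<in> M_set P" "K_map v = K_map u" for v
    using opt[of "x_part v" "y_part v"] that Ku
    by (simp add: u_def h_obj_def M_set_def residual_K_map)
  then obtain l where l: "\<And>v. v \<in> M_set P \<Longrightarrow> h_obj P u + l \<bullet> (K_map v - K_map u) \<le> h_obj P v"
    using convex_polyhedral_multiplier[OF h_obj_convex M_set_polyhedron linear_K_map \<open>u \<in> M_set P\<close>]
    by blast
  define w where "w = stack x y l"
  have "w \<in> M_set P" using feas by (simp add: w_def M_set_def)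
  moreover have "h_obj P w = h_obj P u" "K_map w = K_map u"
    by (simp_all add: w_def u_def h_obj_def K_map_def)
  \<comment> \<open>Since \<open>K_map w = rhs P\<close>, the terms with \<open>l_part v\<close>
    cancel, and what remains is the multiplier inequality.\<close>
  moreover have "0 \<le> h_obj P v - h_obj P u + (v - w) \<bullet> J_map P v" if "v \<in> M_set P" for v
    using l[OF that] \<open>K_map w = K_map u\<close> unfolding inner_J_map linear_diff[OF linear_K_map] part_simps
    by (simp add: Ku w_def inner_diff_left inner_diff_right inner_commute)
  ultimately have "w \<in> M_star P" by (auto simp: M_star_def)
  then show ?thesis by blast
qed

section \<open>Prediction, correction and monotonicity\<close>

text \<open>Passing from the residual at the old \<open>x\<close> to that at \<open>x'\<close>
  produces \<open>- \<beta>\<close> times the full Gram form of \<open>A\<close>, which turns the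
  block-diagonal proximal term into \<open>Hx_mat\<close>.\<close>

lemma x_update_variational_inequality:
  assumes step: "\<And>i. is_arg_min
      (\<lambda>z. aug_lagrangian P \<beta> (replace_block (xblk P) i z x) y l
         + \<sigma>\<^sub>1 * \<beta> / 2 * (norm (A_blk P i *v (z - block (xblk P) i x)))\<^sup>2)
      (\<lambda>z. z \<in> Xset P i) (block (xblk P) i x')"
    and v: "v \<in> X_prod P"
  shows "0 \<le> (\<Sum>i\<in>UNIV. fobj P i (block (xblk P) i v)) - (\<Sum>i\<in>UNIV. fobj P i (block (xblk P) i x'))
    - (A *v (v - x')) \<bullet> (l - \<beta> *\<^sub>R residual P x' y) + (v - x') \<bullet> (Hx_mat P \<beta> \<sigma>\<^sub>1 *v (x' - x))"
proof -
  have "0 \<le> (\<Sum>i\<in>UNIV. fobj P i (block (xblk P) i v)) - (\<Sum>i\<in>UNIV. fobj P i (block (xblk P) i x'))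
    - (A *v (v - x')) \<bullet> (l - \<beta> *\<^sub>R residual P x y)
    + (\<sigma>\<^sub>1 + 1) * \<beta> * (\<Sum>i\<in>UNIV. (A_blk P i *v (v - x')) \<bullet> (A_blk P i *v (x' - x)))"
    unfolding A_blk_def
  proof (rule block_update_variational_inequality[where S = "Xset P"
        and \<phi> = "\<lambda>x. objective P x y" and \<rho> = "\<lambda>x. residual P x y"
        and d = "B *v y - rhs P" and g = "\<Sum>j\<in>UNIV. gobj P j (block (yblk P) j y)"])
    show "block (xblk P) i v \<in> Xset P i" for i using v by (simp add: X_prod_def)
  qed (use step in \<open>simp_all add: f_convex Xset_polyhedron polyhedron_imp_convex Xset_subset
      residual_def objective_def aug_lagrangian_def A_blk_def\<close>)
  moreover have res: "residual P x' y = residual P x y + A *v (x' - x)"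
    by (simp add: residual_def matrix_vector_mult_diff_distrib)
  ultimately show ?thesis
    unfolding Hx_form res scaleR_add_right inner_diff_right inner_add_right inner_scaleR_right
    by linarith
qed

text \<open>Here the residual stays at the old \<open>y\<close>, where the predicted multiplier is
  also formed; so the proximal term remains block diagonal.\<close>

lemma y_update_variational_inequality:
  assumes step: "\<And>j. is_arg_min
      (\<lambda>z. aug_lagrangian P \<beta> x (replace_block (yblk P) j z y) l
         + \<sigma>\<^sub>2 * \<beta> / 2 * (norm (B_blk P j *v (z - block (yblk P) j y)))\<^sup>2)
      (\<lambda>z. z \<in> Yset P j) (block (yblk P) j y')"
    and v: "v \<in> Y_prod P"
  shows "0 \<le> (\<Sum>j\<in>UNIV. gobj P j (block (yblk P) j v)) - (\<Sum>j\<in>UNIV. gobj P j (block (yblk P) j y'))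
    - (B *v (v - y')) \<bullet> (l - \<beta> *\<^sub>R residual P x y) + (\<sigma>\<^sub>2 + 1) * \<beta> * D_form (v - y') (y' - y)"
  unfolding D_form_def B_blk_def
proof (rule block_update_variational_inequality[where S = "Yset P"
      and \<phi> = "objective P x" and \<rho> = "residual P x"
      and d = "A *v x - rhs P" and g = "\<Sum>i\<in>UNIV. fobj P i (block (xblk P) i x)"])
  show "block (yblk P) j v \<in> Yset P j" for j using v by (simp add: Y_prod_def)
  show "objective P x z = (\<Sum>j\<in>UNIV. gobj P j (block (yblk P) j z))
      + (\<Sum>i\<in>UNIV. fobj P i (block (xblk P) i x))" for z
    by (simp add: objective_def)
  show "residual P x z = B *v z + (A *v x - rhs P)" for z by (simp add: residual_def)
qed (use step in \<open>simp_all add: g_convex Yset_polyhedron polyhedron_imp_convex Yset_subset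
    aug_lagrangian_def B_blk_def\<close>)

text \<open>The predicted multiplier is a step of length \<open>\<beta>\<close> along the residual
  at the new \<open>x\<close> and old \<open>y\<close>. This is the multiplier that appears in the
  optimality condition of the \<open>x\<close> update.\<close>

definition predictor where
  "predictor w w' = stack (x_part w') (y_part w') (l_part w - \<beta> *\<^sub>R residual P (x_part w') (y_part w))"

text \<open>The residual at the new \<open>x\<close> and old \<open>y\<close> is the predicted
  multiplier decrease divided by \<open>\<beta>\<close>, and the residual after the \<open>y\<close>
  update differs from it by \<open>B\<close> applied to the change of \<open>y\<close>. Both
  multiplier updates are thus linear in \<open>w - predictor w w'\<close>, with the last row of
  \<open>M\<close> as coefficients.\<close>

lemma gs_admm_step_corrector:
  assumes "gs_admm_step P \<beta> \<sigma>\<^sub>1 \<sigma>\<^sub>2 \<tau> s w w'"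
  shows "w' = w - M *v (w - predictor w w')"
proof -
  have "l_part w' = l_part w - (\<tau> * \<beta>) *\<^sub>R residual P (x_part w') (y_part w)
      - (s * \<beta>) *\<^sub>R residual P (x_part w') (y_part w')"
    using assms by (simp add: gs_admm_step_def Let_def)
  then show ?thesis
    unfolding primal_dual_eq_iff M_mult_vec part_simps
    by (simp add: part_simps predictor_def residual_def algebra_simps matrix_vector_mult_diff_distrib)
qed

lemma predictor_in_M_set:
  assumes "gs_admm_step P \<beta> \<sigma>\<^sub>1 \<sigma>\<^sub>2 \<tau> s w w'"
  shows "predictor w w' \<in> M_set P"
  using assms
  by (auto simp: gs_admm_step_def Let_def predictor_def M_set_def X_prod_def Y_prod_def is_arg_min_linorder)

lemma predictor_variational_inequality:
  assumes step: "gs_admm_step P \<beta> \<sigma>\<^sub>1 \<sigma>\<^sub>2 \<tau> s w w'" and v: "v \<in> M_set P"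
  defines "p \<equiv> predictor w w'"
  shows "0 \<le> h_obj P v - h_obj P p + (v - p) \<bullet> J_map P p + (v - p) \<bullet> (Q *v (p - w))"
proof -
  define x y l x' y' l' where "x = x_part w" and "y = y_part w" and "l = l_part w"
    and "x' = x_part w'" and "y' = y_part w'" and "l' = l - \<beta> *\<^sub>R residual P x' y"
  note defs = this
  have p: "x_part p = x'" "y_part p = y'" "l_part p = l'"
    by (simp_all add: p_def predictor_def defs)
  define a b where "a = A *v (x_part v - x')" and "b = B *v (y_part v - y')"
  have "0 \<le> (\<Sum>i\<in>UNIV. fobj P i (block (xblk P) i (x_part v))) - (\<Sum>i\<in>UNIV. fobj P i (block (xblk P) i x'))
    - a \<bullet> l' + (x_part v - x') \<bullet> (Hx_mat P \<beta> \<sigma>\<^sub>1 *v (x' - x))"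
    unfolding a_def defs(6)
    using step v by (intro x_update_variational_inequality)
      (auto simp: gs_admm_step_def Let_def M_set_def defs)
  moreover have "0 \<le> (\<Sum>j\<in>UNIV. gobj P j (block (yblk P) j (y_part v))) - (\<Sum>j\<in>UNIV. gobj P j (block (yblk P) j y'))
    - b \<bullet> (l - (\<tau> * \<beta>) *\<^sub>R residual P x' y - \<beta> *\<^sub>R residual P x' y)
    + (\<sigma>\<^sub>2 + 1) * \<beta> * D_form (y_part v - y') (y' - y)"
    unfolding b_def
    using step v by (intro y_update_variational_inequality)
      (auto simp: gs_admm_step_def Let_def M_set_def defs)
  \<comment> \<open>Expressing the half-step multiplier through the predicted one creates the entry
    \<open>- \<tau>\<close> in the \<open>y\<close> row of \<open>Q\<close>.\<close>
  moreover have "l - (\<tau> * \<beta>) *\<^sub>R residual P x' y - \<beta> *\<^sub>R residual P x' y = l' + \<tau> *\<^sub>R (l' - l)"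
    by (simp add: defs algebra_simps)
  then have "b \<bullet> (l - (\<tau> * \<beta>) *\<^sub>R residual P x' y - \<beta> *\<^sub>R residual P x' y) = b \<bullet> l' + \<tau> * (b \<bullet> (l' - l))"
    by (simp only: inner_add_right inner_scaleR_right)
  moreover have "(v - p) \<bullet> J_map P p =
      (l_part v - l') \<bullet> (B *v (y' - y)) - (l_part v - l') \<bullet> (l' - l) / \<beta> - a \<bullet> l' - b \<bullet> l'"
  proof -
    \<comment> \<open>The multiplier row is an identity: this residual is cancelled exactly by the
      last row of \<open>Q\<close> applied to \<open>p - w\<close>.\<close>
    have "K_map p - rhs P = B *v (y' - y) - (1 / \<beta>) *\<^sub>R (l' - l)"
      using beta_pos
      by (simp add: K_map_def p defs(6) residual_def matrix_vector_mult_diff_distrib)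
    moreover have "K_map (v - p) = a + b" by (simp add: K_map_def part_simps p a_def b_def)
    ultimately show ?thesis
      unfolding inner_J_map part_simps p
      by (simp add: inner_diff_right[of _ "B *v (y' - y)"] inner_add_left)
  qed
  moreover have "(v - p) \<bullet> (Q *v (p - w)) = (x_part v - x') \<bullet> (Hx_mat P \<beta> \<sigma>\<^sub>1 *v (x' - x))
      + (\<sigma>\<^sub>2 + 1) * \<beta> * D_form (y_part v - y') (y' - y) - \<tau> * (b \<bullet> (l' - l))
      - (l_part v - l') \<bullet> (B *v (y' - y)) + (l_part v - l') \<bullet> (l' - l) / \<beta>"
    unfolding Q_form part_simps p b_def x_def y_def l_def ..
  ultimately show ?thesis
    unfolding h_obj_def objective_def p by linarith
qed

lemma gs_admm_step_fejer:
  assumes step: "gs_admm_step P \<beta> \<sigma>\<^sub>1 \<sigma>\<^sub>2 \<tau> s w w'" and v: "v \<in> M_star P"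
  shows "mat_norm H (w' - v) \<le> mat_norm H (w - v)"
proof -
  define p where "p = predictor w w'"
  have "p \<in> M_set P" unfolding p_def by (rule predictor_in_M_set[OF step])
  then have "v \<in> M_set P" "0 \<le> h_obj P p - h_obj P v + (p - v) \<bullet> J_map P p"
    using v unfolding M_star_def by blast+
  moreover have "0 \<le> h_obj P v - h_obj P p + (v - p) \<bullet> J_map P p + (v - p) \<bullet> (Q *v (p - w))"
    unfolding p_def by (rule predictor_variational_inequality[OF step \<open>v \<in> M_set P\<close>])
  \<comment> \<open>Adding the two inequalities cancels both the objective and \<open>J_map\<close>,
    because each evaluates \<open>J_map\<close> at \<open>p\<close>.\<close>
  ultimately have *: "0 \<le> (p - v) \<bullet> (Q *v (w - p))"
    by (simp add: inner_diff_left matrix_vector_mult_diff_distrib inner_diff_right)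
  define d where "d = w - p"
  have w': "w' - v = (w - v) - M *v d"
    using gs_admm_step_corrector[OF step] by (simp add: d_def p_def algebra_simps)
  have "(M *v d) \<bullet> (H *v (w - v)) = (w - v) \<bullet> (Q *v d)"
    using symmetric_matrix_inner[of H "M *v d" "w - v"] H_pos_def
    by (simp add: sym_pos_def_def H_M_mult_vec)
  then have "(w' - v) \<bullet> (H *v (w' - v)) =
      (w - v) \<bullet> (H *v (w - v)) - 2 * ((w - v) \<bullet> (Q *v d)) + (M *v d) \<bullet> (Q *v d)"
    unfolding w' matrix_vector_mult_diff_distrib[of H "w - v"] H_M_mult_vec
    by (simp add: inner_diff_left inner_diff_right algebra_simps)
  also have "w - v = d + (p - v)" by (simp add: d_def)
  then have "(w - v) \<bullet> (Q *v d) = d \<bullet> (Q *v d) + (p - v) \<bullet> (Q *v d)"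
    by (simp only: inner_add_left)
  \<comment> \<open>The matrix \<open>G\<close> is what collects
    \<open>2 * (d \<bullet> (Q *v d))\<close> and
    \<open>- ((M *v d) \<bullet> (Q *v d))\<close>.\<close>
  finally have "(w' - v) \<bullet> (H *v (w' - v)) =
      (w - v) \<bullet> (H *v (w - v)) - 2 * ((p - v) \<bullet> (Q *v d)) - d \<bullet> (G *v d)"
    by (simp add: G_form)
  moreover have "0 \<le> d \<bullet> (G *v d)" by (rule mat_norm_form_nonneg[OF G_pos_def])
  ultimately show ?thesis using * unfolding mat_norm_def d_def by simp
qed

section \<open>Positivity of the rate constant\<close>

lemma mu_nonneg: "0 \<le> mu P i" and nu_nonneg: "0 \<le> nu P j"
  using standing
  by (auto simp: mu_def nu_def A_blk_def B_blk_def standing_assumptions_def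
      intro!: lambda_max_on_gram_nonneg)

text \<open>The maximum in the denominator is at least \<open>\<delta>\<close>, which is at least
  \<open>eta_bar\<close>, and that contains the positive summand \<open>2 / \<beta>\<^sup>2\<close>.
  The remaining factors are eigenvalues of the positive definite matrices \<open>G\<close> and
  \<open>H\<close>.\<close>

lemma epsilon_pos:
  assumes "\<zeta> > 0" shows "0 < epsilon P \<beta> \<sigma>\<^sub>1 \<sigma>\<^sub>2 \<tau> s \<zeta>"
proof -
  define \<delta> where "\<delta> = delta P \<beta> \<sigma>\<^sub>1 \<sigma>\<^sub>2 \<tau> s"
  have "0 < eta_bar P \<beta> \<tau> s" unfolding eta_bar_def
    using beta_pos by (intro add_nonneg_pos add_nonneg_nonneg mult_nonneg_nonneg sum_nonneg)
      (auto simp: mu_nonneg nu_nonneg)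
  also have "\<dots> \<le> \<delta>" unfolding \<delta>_def delta_def by (intro Max_ge) auto
  also have "\<delta> \<le> Max (range (\<lambda>i. \<delta> * mu P i) \<union> range (\<lambda>j. \<delta> * nu P j) \<union> {\<delta>})"
    by (intro Max_ge) auto
  finally show ?thesis
    using sym_pos_def_lambda_min_pos[OF G_pos_def] sym_pos_def_lambda_max_pos[OF H_pos_def] assms
    unfolding epsilon_def Let_def \<delta>_def[symmetric] by (intro divide_pos_pos mult_pos_pos) auto
qed

end

text \<open>Strict positivity of \<open>C\<close> is asserted only for
  \<open>w 0 \<notin> M_star P\<close>: a start in \<open>M_star\<close> has distance 0 and hence
  \<open>C = 0\<close>. The contraction \<open>\<zeta>\<close> is an assumption because it is the
  defining property of that constant.\<close>

theorem corollary2p1: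
  fixes P :: "('m::finite, 'd::finite, 'n::finite, 'p::finite, 'q::finite) problem"
    and \<beta> \<sigma>\<^sub>1 \<sigma>\<^sub>2 \<tau> s \<zeta> \<epsilon> r C :: real
    and w :: "nat \<Rightarrow> real^('m + 'd + 'n)"
    and H :: "real^('m + 'd + 'n)^('m + 'd + 'n)"
  assumes "standing_assumptions P"
    and "\<beta> > 0"
    and "\<sigma>\<^sub>1 > real CARD('p) - 1"
    and "\<sigma>\<^sub>2 > real CARD('q) - 1"
    and "(\<tau>, s) \<in> stepsize_region"
    and "\<forall>i. piecewise_linear (subdifferential_on (block_space (xblk P) i) (fobj P i))"
    and "\<forall>j. piecewise_linear (subdifferential_on (block_space (yblk P) j) (gobj P j))"
    and "gs_admm P \<beta> \<sigma>\<^sub>1 \<sigma>\<^sub>2 \<tau> s w"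
    and H: "H = H_mat P \<beta> \<sigma>\<^sub>1 \<sigma>\<^sub>2 \<tau> s"
    and \<epsilon>: "\<epsilon> = epsilon P \<beta> \<sigma>\<^sub>1 \<sigma>\<^sub>2 \<tau> s \<zeta>"
    and "\<zeta> > 0"
    and \<zeta>: "\<forall>k. (mat_dist H (w (Suc k)) (M_star P))\<^sup>2
                \<le> 1 / (1 + \<epsilon>) * (mat_dist H (w k) (M_star P))\<^sup>2"
    and r: "r = 1 / sqrt (1 + \<epsilon>)"
    and C: "C = 2 * mat_dist H (w 0) (M_star P) / (1 - r)"
  shows "0 < \<epsilon> \<and> 0 < r \<and> r < 1 \<and> 0 \<le> C \<and> (w 0 \<notin> M_star P \<longrightarrow> 0 < C) \<and>
         (\<exists>w_inf \<in> M_star P. \<forall>k. mat_norm H (w k - w_inf) \<le> C * r ^ k)"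
proof -
  interpret gs_admm_data P \<beta> \<sigma>\<^sub>1 \<sigma>\<^sub>2 \<tau> s by unfold_locales (use assms in auto)
  note pos_def = H_pos_def[folded H]
  have "0 < \<epsilon>" unfolding \<epsilon> using \<open>\<zeta> > 0\<close> by (rule epsilon_pos)
  then have r_bounds: "0 < r" "r < 1" and r2: "r\<^sup>2 = 1 / (1 + \<epsilon>)"
    by (auto simp: r power_divide)
  have contr: "mat_dist H (w (Suc k)) (M_star P) \<le> r * mat_dist H (w k) (M_star P)" for k
  proof (rule power2_le_imp_le)
    show "(mat_dist H (w (Suc k)) (M_star P))\<^sup>2 \<le> (r * mat_dist H (w k) (M_star P))\<^sup>2"
      using \<zeta> unfolding power_mult_distrib r2 by blast
    show "0 \<le> r * mat_dist H (w k) (M_star P)"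
      using r_bounds mat_dist_nonneg[OF pos_def M_star_nonempty] by simp
  qed
  have fejer: "mat_norm H (w (Suc k) - v) \<le> mat_norm H (w k - v)" if "v \<in> M_star P" for k v
    using gs_admm_step_fejer[OF _ that] assms(8) unfolding gs_admm_def H by blast
  have "\<exists>w_inf\<in>M_star P. \<forall>k. mat_norm H (w k - w_inf) \<le> C * r ^ k"
    unfolding C
    by (rule fejer_monotone_linear_convergence[OF pos_def M_star_closed M_star_nonempty
          less_imp_le[OF r_bounds(1)] r_bounds(2), of w, OF fejer contr])
  moreover have "0 \<le> C" unfolding C
    using r_bounds mat_dist_nonneg[OF pos_def M_star_nonempty] by simp
  moreover have "0 < C" if "w 0 \<notin> M_star P" unfolding C
    using r_bounds mat_dist_pos[OF pos_def M_star_closed M_star_nonempty that] by simp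
  ultimately show ?thesis using \<open>0 < \<epsilon>\<close> r_bounds by blast
qed

end
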